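(* Let $n\ge 2$, let $A\in\mathbb{Z}^{m\times n}$ be an integral matrix of full column rank, and suppose there is an integer $k\geq 1$ such that every $n\times n$ minor of $A$ lies in $\{0,\pm k,\pm 2k\}$. Then: (1) For every $b\in\mathbb{Z}^m$, $c\in\mathbb{Q}^n$ and every optimal vertex $x^*$ of $\max\{c^\top x: Ax\le b,\ x\in\mathbb{R}^n\}$, if the integer program $\max\{c^\top x : Ax\le b,\ x\in\mathbb{Z}^n\}$ is feasible, then it has an optimal solution $z^*$ with \[ \|x^*-z^*\|_\infty\le\max\{\Delta_{n-1}(A),\Delta_n(A)\}-1\quad\text{and}\quad \|x^*-z^*\|_\infty<\Delta_{n-1}(A). \] (2) For every $b\in\mathbb{Z}^m$ such that $P=\{x\in\mathbb{R}^n:Ax\le b\}$ is full-dimensional, satisfies $P\cap\mathbb{Z}^n=\emptyset$, and each row of $A$ defines a facet of $P$, there exists a row $a^\top$ of $A$ with \[ w^{a}(P)\le \Delta_n(A)-2. \]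
   Context: For $j\in\{1,\dots,n\}$, $\Delta_j(A)$ denotes the maximum of $|\det M|$ over all $j\times j$ submatrices $M$ of $A$. For $a\in\mathbb{R}^n\setminus\{0\}$, $w^{a}(P)=\max_{x\in P}a^\top x-\min_{y\in P}a^\top y$. *)

theory Defs
  imports "HOL-Analysis.Analysis"
begin

text \<open>Determinant of the j x j submatrix of A whose r-th row is row (f r) of A and whose
  c-th column is column (g c) of A (r, c < j).  Leibniz formula, exactly as the library det.
  Reordering rows/columns only changes the sign, so the absolute values range over
  absolute values of all j x j minors.\<close>
definition sub_det :: "int^'n^'m \<Rightarrow> nat \<Rightarrow> (nat \<Rightarrow> 'm) \<Rightarrow> (nat \<Rightarrow> 'n) \<Rightarrow> int" where
  "sub_det A j f g = (\<Sum>p | p permutes {..<j}. of_int (sign p) * (\<Prod>i<j. A $ f i $ g (p i)))"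

definition Delta :: "nat \<Rightarrow> int^'n^'m \<Rightarrow> int" where
  "Delta j A = Max {\<bar>sub_det A j f g\<bar> | f g. inj_on f {..<j} \<and> inj_on g {..<j}}"

definition real_mat :: "int^'n^'m \<Rightarrow> real^'n^'m" where
  "real_mat A = (\<chi> i j. real_of_int (A $ i $ j))"

definition row_real :: "int^'n^'m \<Rightarrow> 'm \<Rightarrow> real^'n" where
  "row_real A i = (\<chi> j. real_of_int (A $ i $ j))"

definition polyh :: "int^'n^'m \<Rightarrow> int^'m \<Rightarrow> (real^'n) set" where
  "polyh A b = {x. \<forall>i. row_real A i \<bullet> x \<le> real_of_int (b $ i)}"

definition integral_vec :: "real^'n \<Rightarrow> bool" where
  "integral_vec x \<longleftrightarrow> (\<forall>i. x $ i \<in> \<int>)"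

text \<open>Width w^a(P) = max_{x in P} a.x - min_{y in P} a.y (in the extended reals, since P
  may be unbounded in direction a).\<close>
definition width :: "real^'n \<Rightarrow> (real^'n) set \<Rightarrow> ereal" where
  "width a P = (SUP x\<in>P. ereal (a \<bullet> x)) - (INF y\<in>P. ereal (a \<bullet> y))"

end

theory Submission
  imports Defs "HOL-Computational_Algebra.Primes"
begin

text \<open>
  After replacing \<open>k\<close> by \<open>2k\<close> if necessary, some maximal minor equals \<open>\<plusminus>k\<close>. Let \<open>L\<close> be the lattice of all \<open>x\<close> with
  \<open>A x\<close> integral. It contains the integral vectors with index at most \<open>k\<close>, and by Cramer's rule the matrix behaves like a
  bimodular one with respect to \<open>L\<close>: a vertex outside \<open>L\<close> (Veselov and Chirkov) has a neighbour in \<open>L\<close> at distance half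
  an edge direction, and every vector of \<open>L\<close> is a sum of sign-compatible vectors of \<open>L\<close>, each of them the sum of at most two
  halves of edge directions. Here an edge direction is a vector of \<open>(n-1)\<close>-minors divided by \<open>k\<close>. If an integral solution \<open>z\<close>
  is chosen closest to the vertex, its displacement consists of fewer than \<open>k\<close> such summands, for otherwise
  consecutive ones would add up to an integral vector that could be subtracted from \<open>z\<close>. Measured in the coordinate
  directions this gives the proximity bound. For the width bound, increase the right-hand side one unit at a time until an integral
  point first appears, and measure the displacement from the vertex minimising the row that was increased last.
\<close>

section \<open>Minors and cofactor vectors\<close>

text \<open>If 0, k, -k were the only minors, every vertex would lie in the lattice, and an edge
  direction would change no row by more than 1, so it could not overshoot a nonzero integral row
  value. A minor of absolute value 2k breaks both: vertices may miss the lattice, an edge direction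
  may change a row by 2, and its half may leave the lattice. The remedy is that on independent rows
  there are at most two cosets, so two failures cancel. Hence the unit of length is half an edge
  direction, a cofactor vector divided by 2k. The constants come from counting halves: at most k - 1
  steps of two halves each, and one more half if the vertex is outside the lattice. The displacement
  is at most 1 - 1/k, or else 1 - 1/(2k), times the bound on cofactor vectors; but the second case
  forces a minor of absolute value 2k. So the factor is 1 - 1/E with E at most the largest maximal
  minor, which yields both proximity bounds. Measured by a row, cofactor vectors give maximal minors
  again, so the distance is at most that minor minus 1; the width gains another unit because the
  integral point overshoots by one.\<close>

definition minor :: "('m \<Rightarrow> real^'n) \<Rightarrow> ('n \<Rightarrow> 'm) \<Rightarrow> real" where
  "minor a r = det (\<chi> i. a (r i))"

text \<open>The generalised cross product of the rows \<open>r q\<close> with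
  \<open>q \<noteq> p\<close>: it is orthogonal to all of them, and its coordinates are signed
  minors of order n - 1.\<close>

definition cofactor_vec :: "('m \<Rightarrow> real^'n) \<Rightarrow> ('n \<Rightarrow> 'm) \<Rightarrow> 'n \<Rightarrow> real^'n" where
  "cofactor_vec a r p = (\<chi> j. det (\<chi> i. if i = p then axis j 1 else a (r i)))"

text \<open>Stated through a trivial kernel, the form in which it is used; it amounts to a nonzero
  maximal minor with rows in \<open>S\<close> (\<open>minor_nz_spanning_rows\<close>,
  \<open>ex_minor_nz\<close>).\<close>

definition spanning_rows :: "('m \<Rightarrow> real^'n) \<Rightarrow> 'm set \<Rightarrow> bool" where
  "spanning_rows a S \<longleftrightarrow> (\<forall>u. (\<forall>j\<in>S. a j \<bullet> u = 0) \<longrightarrow> u = 0)"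

text \<open>Subtracting a conformal part never crosses zero, so sums of absolute row products drop
  by exactly the part removed; this drives the inductions.\<close>

definition conformal :: "real \<Rightarrow> real \<Rightarrow> bool" where
  "conformal s t \<longleftrightarrow> 0 \<le> s \<and> s \<le> t \<or> t \<le> s \<and> s \<le> 0"

lemma spanning_rows_mono: "spanning_rows a S \<Longrightarrow> S \<subseteq> T \<Longrightarrow> spanning_rows a T"
  unfolding spanning_rows_def by blast

lemma conformal_trans: "conformal s t \<Longrightarrow> conformal t u \<Longrightarrow> conformal s u"
  unfolding conformal_def by auto

lemma conformal_diff: "conformal s t \<Longrightarrow> conformal (t - s) t"
  unfolding conformal_def by auto

lemma conformal_abs_diff: "conformal s t \<Longrightarrow> \<bar>t - s\<bar> = \<bar>t\<bar> - \<bar>s\<bar>"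
  unfolding conformal_def by auto

text \<open>Expansion of the determinant along row \<open>p\<close>, by its linearity in that
  row.\<close>

lemma cofactor_vec_inner:
  "cofactor_vec a r p \<bullet> v = det (\<chi> i. if i = p then v else a (r i))"
proof -
  have "(\<chi> i. if i = p then v else a (r i)) =
      (\<chi> i. if i = p then (\<Sum>j\<in>UNIV. v $ j *s axis j 1) else a (r i))"
    by (subst basis_expansion) simp
  then have "det (\<chi> i. if i = p then v else a (r i)) =
      (\<Sum>j\<in>UNIV. det (\<chi> i. if i = p then v $ j *s axis j 1 else a (r i)))"
    using det_linear_row_sum[where a = "\<lambda>i j. v $ j *s axis j 1" and S = UNIV and k = p
        and c = "\<lambda>i. a (r i)"] by simp
  also have "\<dots> = (\<Sum>j\<in>UNIV. v $ j * det (\<chi> i. if i = p then axis j 1 else a (r i)))"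
    by (intro sum.cong refl det_row_mul)
  finally show ?thesis
    by (simp add: cofactor_vec_def inner_vec_def mult.commute)
qed

lemma cofactor_vec_inner_row: "cofactor_vec a r p \<bullet> a l = minor a (r(p := l))"
proof -
  have "(\<chi> i. if i = p then a l else a (r i)) = (\<chi> i. a ((r(p := l)) i))"
    by (simp add: vec_eq_iff)
  then show ?thesis
    by (simp add: cofactor_vec_inner minor_def)
qed

lemma row_inner_cofactor_vec: "a l \<bullet> cofactor_vec a r p = minor a (r(p := l))"
  by (subst inner_commute) (rule cofactor_vec_inner_row)

lemma minor_eq_0_if_not_inj: "\<not> inj r \<Longrightarrow> minor a r = 0"
proof -
  assume "\<not> inj r"
  then obtain i j where "i \<noteq> j" "r i = r j"
    by (auto simp: inj_def)
  then show ?thesis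
    unfolding minor_def by (intro det_identical_rows[of i j]) (simp_all add: row_def vec_eq_iff)
qed

lemma cofactor_vec_orthogonal:
  assumes "q \<noteq> p"
  shows "cofactor_vec a r p \<bullet> a (r q) = 0"
proof -
  have "\<not> inj (r(p := r q))"
    using assms injD[of "r(p := r q)" p q] by auto
  then show ?thesis
    by (simp add: cofactor_vec_inner_row minor_eq_0_if_not_inj)
qed

lemma minor_nz_ker:
  assumes "minor a r \<noteq> 0" "\<And>i. a (r i) \<bullet> u = 0"
  shows "u = 0"
proof -
  have "invertible (\<chi> i. a (r i))"
    using assms(1) by (simp add: invertible_det_nz minor_def)
  then have "\<exists>B. B ** (\<chi> i. a (r i)) = mat 1"
    unfolding invertible_def by blast
  moreover have "(\<chi> i. a (r i)) *v u = 0"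
    using assms(2) by (simp add: vec_eq_iff matrix_vector_mul_component)
  ultimately show ?thesis
    using matrix_left_invertible_ker by blast
qed

lemma minor_nz_spanning_rows: "minor a r \<noteq> 0 \<Longrightarrow> range r \<subseteq> S \<Longrightarrow> spanning_rows a S"
  using minor_nz_ker unfolding spanning_rows_def by (metis range_subsetD)

lemma ex_minor_nz:
  fixes a :: "'m::finite \<Rightarrow> real^'n"
  assumes "spanning_rows a S"
  obtains r where "range r \<subseteq> S" "minor a r \<noteq> 0"
proof -
  have "span (a ` S) = UNIV"
  proof (rule ccontr)
    assume "span (a ` S) \<noteq> UNIV"
    then obtain u where "u \<noteq> 0" and u: "\<And>v. v \<in> span (a ` S) \<Longrightarrow> orthogonal u v"
      using orthogonal_to_subspace_exists_gen[of "a ` S" UNIV]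
      by (metis psubsetI span_UNIV subset_UNIV top.not_eq_extremum)
    have "a j \<bullet> u = 0" if "j \<in> S" for j
      using u[of "a j"] that by (simp add: orthogonal_def span_base inner_commute)
    then show False
      using \<open>u \<noteq> 0\<close> assms by (auto simp: spanning_rows_def)
  qed
  then obtain B where B: "B \<subseteq> a ` S" "independent B" "span B = UNIV"
    by (metis maximal_independent_subset span_minimal subspace_span top.extremum_uniqueI)
  have "card B = CARD('n)"
    using B by (metis DIM_cart DIM_real dim_UNIV dim_eq_card dim_span mult.right_neutral)
  moreover have "finite B"
    using B(2) by (rule independent_imp_finite)
  ultimately obtain h where h: "bij_betw h (UNIV :: 'n set) B"
    by (metis finite_class.finite_UNIV finite_same_card_bij)
  define r where "r = (\<lambda>i. SOME j. j \<in> S \<and> a j = h i)"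
  have r: "r i \<in> S \<and> a (r i) = h i" for i
  proof -
    have "h i \<in> a ` S"
      using h B(1) by (auto simp: bij_betw_def)
    then have "\<exists>j. j \<in> S \<and> a j = h i"
      by auto
    then show ?thesis
      unfolding r_def by (rule someI_ex)
  qed
  have ker: "u = 0" if "(\<chi> i. a (r i)) *v u = 0" for u
  proof -
    have "a (r i) \<bullet> u = 0" for i
      using that by (simp add: vec_eq_iff matrix_vector_mul_component)
    then have "\<forall>v\<in>B. orthogonal u v"
      using h r by (metis bij_betw_imp_surj_on imageE inner_commute orthogonal_def)
    then have "orthogonal u u"
      using B(3) by (metis UNIV_I orthogonal_to_span)
    then show ?thesis
      by (simp add: orthogonal_def)
  qed
  then have "\<exists>B. B ** (\<chi> i. a (r i)) = mat 1"
    using matrix_left_invertible_ker by blast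
  then have "invertible (\<chi> i. a (r i))"
    by (simp add: invertible_left_inverse)
  then have "minor a r \<noteq> 0"
    by (simp add: invertible_det_nz minor_def)
  then show thesis
    using r that by blast
qed

text \<open>The defect of the expansion of \<open>x\<close> in cofactor vectors is orthogonal to
  every row \<open>r q\<close>, hence zero.\<close>

lemma cramer_rows:
  fixes a :: "'m \<Rightarrow> real^'n"
  assumes "minor a r \<noteq> 0"
  shows "minor a r * (v \<bullet> x) = (\<Sum>p\<in>UNIV. (cofactor_vec a r p \<bullet> v) * (a (r p) \<bullet> x))"
proof -
  define w where "w = (\<Sum>p\<in>UNIV. (a (r p) \<bullet> x) *\<^sub>R cofactor_vec a r p) - minor a r *\<^sub>R x"
  have "a (r q) \<bullet> w = 0" for q
  proof -
    have "a (r q) \<bullet> w = (\<Sum>p\<in>UNIV. (a (r p) \<bullet> x) * (cofactor_vec a r p \<bullet> a (r q)))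
        - minor a r * (a (r q) \<bullet> x)"
      by (simp add: w_def inner_diff_right inner_sum_right inner_commute)
    also have "(\<Sum>p\<in>UNIV. (a (r p) \<bullet> x) * (cofactor_vec a r p \<bullet> a (r q))) =
        (\<Sum>p\<in>UNIV. if p = q then (a (r q) \<bullet> x) * minor a r else 0)"
    proof (intro sum.cong refl)
      fix p
      show "(a (r p) \<bullet> x) * (cofactor_vec a r p \<bullet> a (r q)) = (if p = q then (a (r q) \<bullet> x) * minor a r else 0)"
        by (cases "p = q") (simp add: cofactor_vec_inner_row fun_upd_idem, simp add: cofactor_vec_orthogonal)
    qed
    finally show ?thesis
      by simp
  qed
  then have "w = 0"
    using assms minor_nz_ker by blast
  then have "v \<bullet> w = 0"
    by simp
  then show ?thesis
    by (simp add: w_def inner_diff_right inner_sum_right inner_commute mult.commute)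
qed

section \<open>Extreme rays of the cone of sign-compatible vectors\<close>

text \<open>A ratio test: moving from \<open>v\<close> along \<open>w\<close> or its negative until
  the first row product is about to change sign makes a new one vanish, while those already zero
  stay zero. As \<open>w\<close> is no multiple of \<open>v\<close>, the result is not zero.\<close>

lemma ex_conformal_more_zeros:
  fixes a :: "'m::finite \<Rightarrow> real^'n"
  assumes T: "spanning_rows a T"
    and v: "\<And>c. w \<noteq> c *\<^sub>R v" "\<And>j. j \<in> T \<Longrightarrow> a j \<bullet> v = 0 \<Longrightarrow> a j \<bullet> w = 0"
  obtains v' where "v' \<noteq> 0" "\<forall>j\<in>T. a j \<bullet> v \<ge> 0 \<longrightarrow> a j \<bullet> v' \<ge> 0"
    "\<forall>j\<in>T. a j \<bullet> v \<le> 0 \<longrightarrow> a j \<bullet> v' \<le> 0"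
    "{j\<in>T. a j \<bullet> v = 0} \<subset> {j\<in>T. a j \<bullet> v' = 0}"
proof -
  have "w \<noteq> 0"
    using v(1)[of 0] by simp
  then obtain j0 where j0: "j0 \<in> T" "a j0 \<bullet> w \<noteq> 0"
    using T by (auto simp: spanning_rows_def)
  then have j0v: "a j0 \<bullet> v \<noteq> 0"
    using v(2) by blast
  \<comment> \<open>The sign makes row \<open>j0\<close> shrink along the move, so \<open>J\<close>
    is nonempty and the minimal ratio exists.\<close>
  define s where "s = (if (a j0 \<bullet> w) * (a j0 \<bullet> v) > 0 then 1 else -1 :: real)"
  define u where "u = s *\<^sub>R w"
  have u0: "a j \<bullet> u = 0" if "j \<in> T" "a j \<bullet> v = 0" for j
    using v(2) that by (simp add: u_def)
  have uv: "u \<noteq> c *\<^sub>R v" for c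
  proof
    assume "u = c *\<^sub>R v"
    then have "s *\<^sub>R u = (s * c) *\<^sub>R v"
      by simp
    moreover have "s *\<^sub>R u = w"
      by (simp add: u_def s_def)
    ultimately show False
      using v(1)[of "s * c"] by simp
  qed
  define J where "J = {j\<in>T. (a j \<bullet> u) * (a j \<bullet> v) > 0}"
  have "j0 \<in> J"
    using j0 j0v by (cases "(a j0 \<bullet> w) * (a j0 \<bullet> v) > 0") (simp_all add: J_def u_def s_def not_less order_le_less)
  define t where "t = Min ((\<lambda>j. (a j \<bullet> v) / (a j \<bullet> u)) ` J)"
  have fin: "finite ((\<lambda>j. (a j \<bullet> v) / (a j \<bullet> u)) ` J)" by simp
  have "t \<in> (\<lambda>j. (a j \<bullet> v) / (a j \<bullet> u)) ` J"
    unfolding t_def using \<open>j0 \<in> J\<close> by (intro Min_in) auto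
  then obtain j1 where j1: "j1 \<in> J" "t = (a j1 \<bullet> v) / (a j1 \<bullet> u)" by auto
  have "t > 0"
    using j1 by (auto simp: J_def zero_less_mult_iff zero_less_divide_iff)
  have tle: "t \<le> (a j \<bullet> v) / (a j \<bullet> u)" if "j \<in> J" for j
    unfolding t_def using that by (intro Min_le) auto
  define v' where "v' = v - t *\<^sub>R u"
  have v': "a j \<bullet> v' = a j \<bullet> v - t * (a j \<bullet> u)" for j
    by (simp add: v'_def inner_diff_right)
  show thesis
  proof (rule that[of v'])
    show "v' \<noteq> 0"
    proof
      assume "v' = 0"
      then have "v = t *\<^sub>R u" by (simp add: v'_def)
      then have "u = (1 / t) *\<^sub>R v"
        using \<open>t > 0\<close> by simp
      then show False using uv by blast
    qed
  next
    show "\<forall>j\<in>T. a j \<bullet> v \<ge> 0 \<longrightarrow> a j \<bullet> v' \<ge> 0"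
    proof (intro ballI impI)
      fix j assume j: "j \<in> T" "a j \<bullet> v \<ge> 0"
      show "a j \<bullet> v' \<ge> 0"
      proof (cases "a j \<bullet> v = 0 \<or> a j \<bullet> u \<le> 0")
        case True
        then show ?thesis
        proof
          assume "a j \<bullet> v = 0" then show ?thesis using u0 j by (simp add: v')
        next
          assume "a j \<bullet> u \<le> 0"
          then have "t * (a j \<bullet> u) \<le> 0" using \<open>t > 0\<close> by (simp add: mult_le_0_iff)
          then show ?thesis using j by (simp add: v')
        qed
      next
        case False
        then have "t \<le> (a j \<bullet> v) / (a j \<bullet> u)"
          using j by (intro tle) (auto simp: J_def)
        then show ?thesis
          using False by (simp add: v' field_simps)
      qed
    qed
  next
    show "\<forall>j\<in>T. a j \<bullet> v \<le> 0 \<longrightarrow> a j \<bullet> v' \<le> 0"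
    proof (intro ballI impI)
      fix j assume j: "j \<in> T" "a j \<bullet> v \<le> 0"
      show "a j \<bullet> v' \<le> 0"
      proof (cases "a j \<bullet> v = 0 \<or> a j \<bullet> u \<ge> 0")
        case True
        then show ?thesis
        proof
          assume "a j \<bullet> v = 0" then show ?thesis using u0 j by (simp add: v')
        next
          assume "a j \<bullet> u \<ge> 0"
          then have "t * (a j \<bullet> u) \<ge> 0" using \<open>t > 0\<close> by simp
          then show ?thesis using j by (simp add: v')
        qed
      next
        case False
        then have "t \<le> (a j \<bullet> v) / (a j \<bullet> u)"
          using j by (intro tle) (auto simp: J_def mult_neg_neg)
        then show ?thesis
          using False by (simp add: v' field_simps)
      qed
    qed
  next
    have "a j1 \<bullet> v' = 0" "a j1 \<bullet> v \<noteq> 0" "j1 \<in> T"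
      using j1 by (auto simp: v' J_def)
    then show "{j\<in>T. a j \<bullet> v = 0} \<subset> {j\<in>T. a j \<bullet> v' = 0}"
      using u0 by (auto simp: v')
  qed
qed

text \<open>Among the nonzero vectors with the signs of \<open>d\<close>, one with the most
  vanishing rows in \<open>T\<close> spans an extreme ray. Its zero rows determine it up to a
  factor, so together with one further row they span, and it is proportional to a cofactor
  vector.\<close>

lemma ex_conformal_cofactor_vec:
  fixes a :: "'m::finite \<Rightarrow> real^'n"
  assumes T: "spanning_rows a T" and "d \<noteq> 0"
  obtains r p s where "range r \<subseteq> T" "minor a r \<noteq> 0" "s = 1 \<or> s = (-1::real)"
    "\<forall>j\<in>T. a j \<bullet> d \<ge> 0 \<longrightarrow> a j \<bullet> (s *\<^sub>R cofactor_vec a r p) \<ge> 0"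
    "\<forall>j\<in>T. a j \<bullet> d \<le> 0 \<longrightarrow> a j \<bullet> (s *\<^sub>R cofactor_vec a r p) \<le> 0"
proof -
  define C where "C = (\<lambda>v. v \<noteq> 0 \<and> (\<forall>j\<in>T. (a j \<bullet> d \<ge> 0 \<longrightarrow> a j \<bullet> v \<ge> 0) \<and> (a j \<bullet> d \<le> 0 \<longrightarrow> a j \<bullet> v \<le> 0)))"
  define z where "z = (\<lambda>v. card {j\<in>T. a j \<bullet> v = 0})"
  have "C d" using \<open>d \<noteq> 0\<close> by (simp add: C_def)
  moreover have "\<forall>v. C v \<longrightarrow> z v \<le> card T"
    by (auto simp: z_def intro: card_mono)
  ultimately obtain v where v: "C v" "\<And>w. C w \<Longrightarrow> z w \<le> z v"
    using Lattices_Big.ex_has_greatest_nat[of C d z "Suc (card T)"] by (auto simp: less_Suc_eq_le)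
  \<comment> \<open>By maximality, the vanishing rows of \<open>v\<close> leave no direction but its
    own line.\<close>
  have par: "\<exists>c. w = c *\<^sub>R v" if w: "\<And>j. j \<in> T \<Longrightarrow> a j \<bullet> v = 0 \<Longrightarrow> a j \<bullet> w = 0" for w
  proof (rule ccontr)
    assume "\<nexists>c. w = c *\<^sub>R v"
    then have nw: "\<And>c. w \<noteq> c *\<^sub>R v" by blast
    obtain v' where v': "v' \<noteq> 0" "\<forall>j\<in>T. a j \<bullet> v \<ge> 0 \<longrightarrow> a j \<bullet> v' \<ge> 0"
      "\<forall>j\<in>T. a j \<bullet> v \<le> 0 \<longrightarrow> a j \<bullet> v' \<le> 0"
      "{j\<in>T. a j \<bullet> v = 0} \<subset> {j\<in>T. a j \<bullet> v' = 0}"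
      by (rule ex_conformal_more_zeros[OF T nw w])
    have "C v'"
      using v(1) v' by (auto simp: C_def)
    moreover have "z v < z v'"
      unfolding z_def using v'(4) by (intro psubset_card_mono) auto
    ultimately show False
      using v(2) by fastforce
  qed
  obtain j0 where j0: "j0 \<in> T" "a j0 \<bullet> v \<noteq> 0"
    using v(1) T by (auto simp: C_def spanning_rows_def)
  define Z where "Z = {j\<in>T. a j \<bullet> v = 0}"
  have "spanning_rows a (insert j0 Z)"
    unfolding spanning_rows_def
  proof (intro allI impI)
    fix u assume u: "\<forall>j\<in>insert j0 Z. a j \<bullet> u = 0"
    then obtain c where "u = c *\<^sub>R v"
      using par[of u] by (auto simp: Z_def)
    then show "u = 0" using u j0 by auto
  qed
  then obtain r where r: "range r \<subseteq> insert j0 Z" "minor a r \<noteq> 0"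
    by (rule ex_minor_nz)
  obtain p where p: "r p \<notin> Z"
  proof (rule ccontr)
    assume "\<not> thesis"
    then have "a (r i) \<bullet> v = 0" for i
      using that by (auto simp: Z_def)
    then have "v = 0" using r(2) minor_nz_ker by blast
    then show False using v(1) by (simp add: C_def)
  qed
  then have rp: "r p = j0" using r(1) by auto
  define g where "g = cofactor_vec a r p"
  have gj0: "a j0 \<bullet> g \<noteq> 0"
    using r(2) rp by (simp add: g_def row_inner_cofactor_vec fun_upd_idem)
  have "inj r" using r(2) minor_eq_0_if_not_inj by blast
  have rq: "r q \<in> Z" if "q \<noteq> p" for q
    using r(1) rp that \<open>inj r\<close> by (metis injD insertE range_subsetD)
  define c where "c = (a j0 \<bullet> g) / (a j0 \<bullet> v)"
  have "g - c *\<^sub>R v = 0"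
  proof (rule minor_nz_ker[OF r(2)])
    fix q
    show "a (r q) \<bullet> (g - c *\<^sub>R v) = 0"
    proof (cases "q = p")
      case True
      then show ?thesis using j0 rp by (simp add: inner_diff_right c_def)
    next
      case False
      then show ?thesis
        using rq[OF False] cofactor_vec_orthogonal[OF False, of a r]
        by (simp add: inner_diff_right Z_def g_def inner_commute)
    qed
  qed
  then have gc: "g = c *\<^sub>R v" by simp
  have c0: "c \<noteq> 0" using gj0 j0 by (simp add: c_def)
  show thesis
  proof (rule that[of r "sgn c" p])
    show "range r \<subseteq> T" using r(1) j0 by (auto simp: Z_def)
    show "sgn c = 1 \<or> sgn c = -1" using c0 by (simp add: sgn_if)
    have eq: "a j \<bullet> (sgn c *\<^sub>R cofactor_vec a r p) = \<bar>c\<bar> * (a j \<bullet> v)" for j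
      using gc by (simp add: g_def[symmetric] abs_sgn mult.commute mult.left_commute)
    show "\<forall>j\<in>T. a j \<bullet> d \<ge> 0 \<longrightarrow> a j \<bullet> (sgn c *\<^sub>R cofactor_vec a r p) \<ge> 0"
      using v(1) unfolding eq by (auto simp: C_def)
    show "\<forall>j\<in>T. a j \<bullet> d \<le> 0 \<longrightarrow> a j \<bullet> (sgn c *\<^sub>R cofactor_vec a r p) \<le> 0"
      using v(1) unfolding eq by (auto simp: C_def mult_nonneg_nonpos)
  qed (use r in auto)
qed

section \<open>Integral vectors modulo a sublattice\<close>

lemma integral_vec_0 [simp]: "integral_vec 0"
  by (simp add: integral_vec_def)

lemma integral_vec_diff: "integral_vec x \<Longrightarrow> integral_vec y \<Longrightarrow> integral_vec (x - y)"
  by (simp add: integral_vec_def)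

lemma integral_vec_add: "integral_vec x \<Longrightarrow> integral_vec y \<Longrightarrow> integral_vec (x + y)"
  by (simp add: integral_vec_def)

lemma integral_vec_scaleR: "c \<in> \<int> \<Longrightarrow> integral_vec x \<Longrightarrow> integral_vec (c *\<^sub>R x)"
  by (simp add: integral_vec_def)

lemma integral_vec_inner: "integral_vec x \<Longrightarrow> integral_vec y \<Longrightarrow> x \<bullet> y \<in> \<int>"
  by (auto simp: integral_vec_def inner_vec_def intro!: Ints_sum Ints_mult)

lemma integral_matrix_mult:
  fixes B :: "real^'n^'m"
  shows "(\<And>i. integral_vec (B $ i)) \<Longrightarrow> integral_vec m \<Longrightarrow> integral_vec (B *v m)"
  using integral_vec_inner by (auto simp: integral_vec_def[of "B *v m"] matrix_vector_mul_component)

lemma det_Ints: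
  fixes B :: "real^'n^'n"
  shows "(\<And>i. integral_vec (B $ i)) \<Longrightarrow> det B \<in> \<int>"
  by (auto simp: det_def integral_vec_def intro!: Ints_sum Ints_mult Ints_prod)

lemma det_mult_integral_vec:
  fixes B :: "real^'n^'n"
  assumes "\<And>i. integral_vec (B $ i)" "integral_vec (B *v x)"
  shows "integral_vec (det B *\<^sub>R x)"
proof -
  have "x $ j * det B \<in> \<int>" for j
    unfolding cramer_lemma[of j B x, symmetric]
    using assms by (intro det_Ints) (auto simp: integral_vec_def)
  then show ?thesis
    by (simp add: integral_vec_def mult.commute)
qed

text \<open>If \<open>n\<close> is the order of \<open>x\<close> modulo the integral vectors and
  \<open>p\<close> a prime factor of it, then \<open>q = n div p\<close> times \<open>x\<close> has
  a coordinate w/p with w prime to \<open>p\<close>. Multiplying by an inverse of w modulo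
  \<open>p\<close> and shifting by an integer turns this coordinate into exactly 1/p.\<close>

lemma ex_prime_fraction_vec:
  fixes x :: "real^'n"
  assumes x: "\<not> integral_vec x" and k: "k > 0" "integral_vec (real k *\<^sub>R x)"
  obtains p :: nat and c :: int and m :: "real^'n" and j
  where "prime p" "integral_vec m" "integral_vec (real p *\<^sub>R (of_int c *\<^sub>R x - m))"
    "(of_int c *\<^sub>R x - m) $ j = 1 / real p"
proof -
  define P where "P = (\<lambda>n::nat. n > 0 \<and> integral_vec (real n *\<^sub>R x))"
  define n where "n = (LEAST n. P n)"
  have "P k" using k by (simp add: P_def)
  then have n: "P n" unfolding n_def by (rule LeastI)
  have "n \<noteq> 1" using n x by (auto simp: P_def)
  then obtain p where p: "prime p" "p dvd n"
    using prime_factor_nat by blast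
  then obtain q where q: "n = p * q" by auto
  have "q > 0" "q < n" using n q p(1) prime_gt_1_nat by (auto simp: P_def)
  then have "\<not> integral_vec (real q *\<^sub>R x)"
    using not_less_Least[of q P] by (auto simp: n_def P_def)
  then obtain j where j: "real q * x $ j \<notin> \<int>"
    by (auto simp: integral_vec_def)
  have "real p * (real q * x $ j) \<in> \<int>"
    using n q by (simp add: P_def integral_vec_def mult.assoc)
  then obtain w where w: "real p * (real q * x $ j) = of_int w"
    by (auto elim: Ints_cases)
  have p0: "real p > 0" using p(1) prime_gt_0_nat by simp
  have "\<not> int p dvd w"
  proof
    assume "int p dvd w"
    then obtain u where "w = int p * u" by auto
    then have "real q * x $ j = of_int u" using w p0 by simp
    then show False using j by simp
  qed
  then have "coprime w (int p)"
    using p(1) prime_imp_coprime[of "int p" w] by (simp add: coprime_commute)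
  then obtain t v where "t * w + v * int p = 1"
    using bezout_int[of w "int p"] by auto
  moreover define u where "u = - v"
  ultimately have u: "w * t = 1 + int p * u"
    by (simp add: algebra_simps)
  define c where "c = t * int q"
  define m :: "real^'n" where "m = axis j (of_int u)"
  have "integral_vec m" by (simp add: m_def integral_vec_def axis_def)
  moreover have "integral_vec (real p *\<^sub>R (of_int c *\<^sub>R x - m))"
  proof -
    have "real p *\<^sub>R (of_int c *\<^sub>R x - m) = of_int t *\<^sub>R (real n *\<^sub>R x) - real p *\<^sub>R m"
      by (simp add: q c_def algebra_simps)
    moreover have "integral_vec (of_int t *\<^sub>R (real n *\<^sub>R x))" "integral_vec (real p *\<^sub>R m)"
      using n \<open>integral_vec m\<close> by (auto simp only: P_def intro!: integral_vec_scaleR Ints_of_int Ints_of_nat)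
    ultimately show ?thesis
      by (simp only: integral_vec_diff)
  qed
  moreover have "(of_int c *\<^sub>R x - m) $ j = 1 / real p"
  proof -
    have "real p * ((of_int c *\<^sub>R x - m) $ j) = of_int t * (real p * (real q * x $ j)) - real p * of_int u"
      by (simp add: c_def m_def algebra_simps)
    also have "\<dots> = of_int (w * t - int p * u)"
      by (simp add: w)
    also have "\<dots> = 1" by (simp add: u)
    finally show ?thesis using p0 by (simp add: field_simps)
  qed
  ultimately show thesis
    by (rule that[OF p(1)])
qed

text \<open>Induction on the determinant: a vector of prime order \<open>p\<close> modulo the integral vectors can be normalised to
  have some coordinate \<open>1/p\<close>; adjoining it to the integral vectors amounts to a change of basis that divides
  the determinant by \<open>p\<close>.\<close>

lemma ex_coset_representatives:
  fixes B :: "real^'n^'n"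
  assumes "\<And>i. integral_vec (B $ i)" "\<bar>det B\<bar> = real k" "k > 0"
  shows "\<exists>R. finite R \<and> card R \<le> k \<and> (\<forall>x. integral_vec (B *v x) \<longrightarrow> (\<exists>r\<in>R. integral_vec (x - r)))"
  using assms
proof (induction k arbitrary: B rule: less_induct)
  case (less k B)
  show ?case
  proof (cases "\<forall>x. integral_vec (B *v x) \<longrightarrow> integral_vec x")
    case True
    then show ?thesis
      using less.prems(3) by (intro exI[of _ "{0}"]) auto
  next
    case False
    then obtain x where x: "integral_vec (B *v x)" "\<not> integral_vec x" by blast
    have "integral_vec (det B *\<^sub>R x)"
      using less.prems(1) x(1) by (rule det_mult_integral_vec)
    then have "integral_vec (sgn (det B) *\<^sub>R (det B *\<^sub>R x))"
      by (rule integral_vec_scaleR[rotated]) (auto simp: sgn_if)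
    then have "integral_vec (real k *\<^sub>R x)"
      using less.prems(2) by (simp add: abs_sgn mult.commute)
    with x(2) less.prems(3) obtain p :: nat and c :: int and m j
      where p: "prime p" "integral_vec m" "integral_vec (real p *\<^sub>R (of_int c *\<^sub>R x - m))"
        "(of_int c *\<^sub>R x - m) $ j = 1 / real p"
      by (rule ex_prime_fraction_vec)
    define y where "y = of_int c *\<^sub>R x - m"
    have p1: "p > 1" using p(1) prime_gt_1_nat by blast
    have By: "integral_vec (B *v y)"
      using x(1) integral_matrix_mult[OF less.prems(1) p(2)]
      by (auto simp: y_def matrix_vector_mult_diff_distrib matrix_vector_mult_scaleR
          intro!: integral_vec_diff integral_vec_scaleR)
    \<comment> \<open>The columns of \<open>C\<close> generate the integral vectors together with
      \<open>y\<close>: column \<open>j\<close> of the identity is recovered because p times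
      \<open>y\<close> is integral with coordinate \<open>j\<close> equal to 1.\<close>
    define C :: "real^'n^'n" where "C = (\<chi> i l. if l = j then y $ i else mat 1 $ i $ l)"
    have "det C = y $ j * det (mat 1 :: real^'n^'n)"
      using cramer_lemma[of j "mat 1 :: real^'n^'n" y] unfolding matrix_vector_mul_lid C_def .
    then have detC: "det C = 1 / real p"
      using p(4) by (simp add: y_def)
    have Cv: "C *v v = v - (v $ j) *\<^sub>R axis j 1 + (v $ j) *\<^sub>R y" for v
    proof -
      have "(C *v v) $ i = (v - (v $ j) *\<^sub>R axis j 1 + (v $ j) *\<^sub>R y) $ i" for i
      proof -
        have "(C *v v) $ i = (\<Sum>l\<in>UNIV. (if l = j then y $ i * v $ j else 0) + (if l = i then v $ i else 0)
            - (if l = j then (if i = j then v $ j else 0) else 0))"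
          unfolding matrix_vector_mult_def C_def mat_def
          by (subst vec_lambda_beta, intro sum.cong refl) simp
        also have "\<dots> = y $ i * v $ j + v $ i - (if i = j then v $ j else 0)"
          by (simp add: sum.distrib sum_subtractf)
        finally show ?thesis by (simp add: axis_def)
      qed
      then show ?thesis by (simp add: vec_eq_iff)
    qed
    define B' where "B' = B ** C"
    have B'int: "integral_vec (B' $ i)" for i
    proof -
      have "B' $ i $ l \<in> \<int>" for l
      proof -
        have "B' $ i $ l = (B' *v axis l 1) $ i"
          by (simp add: matrix_vector_mult_basis column_def)
        also have "B' *v axis l 1 = B *v (C *v axis l 1)"
          by (simp add: B'_def matrix_vector_mul_assoc)
        also have "C *v axis l 1 = (if l = j then y else axis l 1)"
          by (simp add: Cv axis_def)
        also have "(B *v (if l = j then y else axis l 1)) $ i \<in> \<int>"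
          using By integral_matrix_mult[OF less.prems(1), of "axis l 1"]
          by (auto simp: integral_vec_def axis_def)
        finally show ?thesis .
      qed
      then show ?thesis by (simp add: integral_vec_def)
    qed
    have det': "\<bar>det B'\<bar> = real k / real p"
      using less.prems(2) p1 by (simp add: B'_def det_mul detC abs_mult)
    obtain b where "det B' = of_int b"
      using det_Ints[OF B'int] by (auto elim: Ints_cases)
    define k' where "k' = nat \<bar>b\<bar>"
    have k': "\<bar>det B'\<bar> = real k'"
      using \<open>det B' = of_int b\<close> by (simp add: k'_def)
    have kk: "k = p * k'"
      using det' k' p1 by (simp add: field_simps flip: of_nat_mult)
    have k'0: "k' > 0" "k' < k" using kk less.prems(3) p1 by auto
    obtain R where R: "finite R" "card R \<le> k'" "\<And>v. integral_vec (B' *v v) \<Longrightarrow> \<exists>r\<in>R. integral_vec (v - r)"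
      using less.IH[OF k'0(2) B'int k' k'0(1)] by blast
    \<comment> \<open>Each representative for \<open>B'\<close> splits into \<open>p\<close> of them
      for \<open>B\<close>, one for every multiple of \<open>y\<close> below
      \<open>p\<close>.\<close>
    define R' where "R' = (\<lambda>(r, t). C *v r + real t *\<^sub>R y) ` (R \<times> {..<p})"
    have "finite R'" using R by (simp add: R'_def)
    moreover have "card R' \<le> k"
    proof -
      have "card R' \<le> card (R \<times> {..<p})" unfolding R'_def using R by (intro card_image_le) auto
      also have "\<dots> \<le> k" using R(2) by (simp add: card_cartesian_product kk mult.commute)
      finally show ?thesis .
    qed
    moreover have "\<exists>r\<in>R'. integral_vec (v - r)" if v: "integral_vec (B *v v)" for v
    proof -
      have "invertible C" using detC p1 by (simp add: invertible_det_nz)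
      then obtain C' where "C ** C' = mat 1" unfolding invertible_def by blast
      then have CC': "C *v (C' *v v) = v" by (simp add: matrix_vector_mul_assoc)
      have "B' *v (C' *v v) = B *v v"
        using CC' by (simp add: B'_def matrix_vector_mul_assoc[symmetric])
      then obtain r where r: "r \<in> R" "integral_vec (C' *v v - r)"
        using R(3) v by metis
      define w where "w = C' *v v - r"
      obtain a where a: "w $ j = of_int a"
        using r(2) by (auto simp: w_def integral_vec_def elim: Ints_cases)
      \<comment> \<open>The quotient by \<open>p\<close> contributes a multiple of the integral
        vector p times \<open>y\<close>; only the remainder is left.\<close>
      define t where "t = nat (a mod int p)"
      have t: "t < p" "int t = a mod int p" using p1 by (auto simp: t_def nat_less_iff)
      have "a = int p * (a div int p) + int t" by (simp add: t)
      then have at: "of_int a = real p * of_int (a div int p) + (real t :: real)"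
        by (metis of_int_add of_int_mult of_int_of_nat_eq)
      have "v - (C *v r + real t *\<^sub>R y) = C *v w - real t *\<^sub>R y"
        by (simp add: w_def matrix_vector_mult_diff_distrib CC')
      also have "\<dots> = w - of_int a *\<^sub>R axis j 1 + of_int (a div int p) *\<^sub>R (real p *\<^sub>R y)"
        by (simp add: Cv a) (simp add: at algebra_simps)
      finally have eq: "v - (C *v r + real t *\<^sub>R y) =
          w - of_int a *\<^sub>R axis j 1 + of_int (a div int p) *\<^sub>R (real p *\<^sub>R y)" .
      have "integral_vec w" "integral_vec (real p *\<^sub>R y)" "integral_vec (axis j (1::real))"
        using r(2) p(3) by (simp_all add: w_def y_def) (simp add: integral_vec_def axis_def)
      then have "integral_vec (v - (C *v r + real t *\<^sub>R y))"
        unfolding eq by (intro integral_vec_add integral_vec_diff integral_vec_scaleR[OF Ints_of_int])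
      then show ?thesis
        unfolding R'_def using r(1) t(1) by (intro bexI[of _ "C *v r + real t *\<^sub>R y"]) auto
    qed
    ultimately show ?thesis by blast
  qed
qed

lemma integral_pigeonhole:
  fixes B :: "real^'n^'n" and s :: "nat \<Rightarrow> real^'n" and k :: nat
  assumes B: "\<And>i. integral_vec (B $ i)" and det: "\<bar>det B\<bar> = real k" and "k > 0"
    and s: "\<And>t. t \<le> k \<Longrightarrow> integral_vec (B *v s t)"
  obtains p q where "p < q" "q \<le> k" "integral_vec (s q - s p)"
proof -
  obtain R where R: "finite R" "card R \<le> k" "\<And>x. integral_vec (B *v x) \<Longrightarrow> \<exists>r\<in>R. integral_vec (x - r)"
    using ex_coset_representatives[OF B det \<open>k > 0\<close>] by blast
  define f where "f = (\<lambda>t. SOME r. r \<in> R \<and> integral_vec (s t - r))"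
  have f: "f t \<in> R \<and> integral_vec (s t - f t)" if "t \<le> k" for t
  proof -
    have "\<exists>r. r \<in> R \<and> integral_vec (s t - r)"
      using R(3)[OF s[OF that]] by blast
    then show ?thesis unfolding f_def by (rule someI_ex)
  qed
  have "\<not> inj_on f {..k}"
  proof
    assume "inj_on f {..k}"
    then have "card {..k} \<le> card R" using R(1) f by (intro card_inj_on_le) auto
    then show False using R(2) by simp
  qed
  then obtain t u where tu: "t \<le> k" "u \<le> k" "t \<noteq> u" "f t = f u"
    by (auto simp: inj_on_def)
  define p q where "p = min t u" "q = max t u"
  have pq: "p < q" "q \<le> k" "f p = f q" using tu by (auto simp: p_q_def min_def max_def)
  have "integral_vec ((s q - f q) - (s p - f p))"
    using f[of p] f[of q] pq by (intro integral_vec_diff[of "s q - f q"]) auto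
  then show thesis using that pq by simp
qed

section \<open>The lattice of vectors with integral row products\<close>

lemma half_integers_add_Ints:
  fixes s t :: real
  assumes "2 * s \<in> \<int>" "2 * t \<in> \<int>" "s \<notin> \<int>" "t \<notin> \<int>"
  shows "s + t \<in> \<int>"
proof -
  obtain m n where m: "2 * s = of_int m" and n: "2 * t = of_int n"
    using assms(1,2) by (auto elim!: Ints_cases)
  have "odd m"
  proof
    assume "even m"
    then obtain q where "m = 2 * q" by auto
    then have "s = of_int q" using m by simp
    then show False using assms(3) by simp
  qed
  moreover have "odd n"
  proof
    assume "even n"
    then obtain q where "n = 2 * q" by auto
    then have "t = of_int q" using n by simp
    then show False using assms(4) by simp
  qed
  ultimately have "even (m + n)" by simp
  then obtain q where "m + n = 2 * q" by (rule dvdE)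
  then have "2 * s + 2 * t = 2 * of_int q" using m n by (metis of_int_add of_int_mult of_int_numeral)
  then have "s + t = of_int q" by simp
  then show ?thesis by simp
qed

lemma Ints_less_add_1:
  fixes x m :: real
  assumes "x \<in> \<int>" "m \<in> \<int>" "x < m + 1"
  shows "x \<le> m"
  using assms Ints_nonzero_abs_ge1[of "x - m"] by (cases "x = m") auto

text \<open>The standing hypothesis, normalised so that \<open>k\<close> itself occurs among the absolute values of the minors.\<close>

locale two_modular =
  fixes a :: "'m::finite \<Rightarrow> real^'n" and k :: nat
  assumes k_pos: "k > 0"
    and minor_cases: "minor a r \<in> {0, real k, - real k, 2 * real k, - (2 * real k)}"
    and ex_minor_k: "\<exists>r. \<bar>minor a r\<bar> = real k"
    and integral_row: "integral_vec (a j)"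
begin

definition row_integral :: "real^'n \<Rightarrow> bool" where
  "row_integral x \<longleftrightarrow> (\<forall>j. a j \<bullet> x \<in> \<int>)"

text \<open>Normalised so that every row product is 0, 1/2 or 1 up to sign
  (\<open>row_half_step\<close>); twice a half step is an edge direction.\<close>

definition half_steps :: "(real^'n) set" where
  "half_steps = {(s / (2 * real k)) *\<^sub>R cofactor_vec a r p | s r p. s = 1 \<or> s = -1}"

text \<open>The functional stays abstract to serve both parts: a coordinate with a bound on minors
  of order n - 1 for proximity, a row with a bound on maximal minors for the width.\<close>

definition step_bound :: "real^'n \<Rightarrow> real \<Rightarrow> bool" where
  "step_bound f \<beta> \<longleftrightarrow> (\<forall>r p. \<bar>f \<bullet> cofactor_vec a r p\<bar> \<le> \<beta>)"

lemma row_integral_diff: "row_integral x \<Longrightarrow> row_integral y \<Longrightarrow> row_integral (x - y)"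
  by (simp add: row_integral_def inner_diff_right)

lemma integral_imp_row_integral: "integral_vec x \<Longrightarrow> row_integral x"
  by (simp add: row_integral_def integral_vec_inner integral_row)

lemma spanning_UNIV: "spanning_rows a UNIV"
  using ex_minor_k k_pos minor_nz_spanning_rows[of a _ UNIV] by fastforce

text \<open>Cramer's rule with ratios of minors as coefficients: integers if the denominator is k or
  -k, and always integers or halves of integers. The next three lemmas read off integrality from
  this.\<close>

lemma row_expansion:
  assumes "minor a r \<noteq> 0"
  shows "a l \<bullet> x = (\<Sum>p\<in>UNIV. (minor a (r(p := l)) / minor a r) * (a (r p) \<bullet> x))"
proof -
  have "minor a r * (a l \<bullet> x) = (\<Sum>p\<in>UNIV. minor a (r(p := l)) * (a (r p) \<bullet> x))"
    using cramer_rows[OF assms, of "a l" x] by (simp add: cofactor_vec_inner_row)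
  then have "a l \<bullet> x = (\<Sum>p\<in>UNIV. minor a (r(p := l)) * (a (r p) \<bullet> x)) / minor a r"
    using assms by (simp add: field_simps)
  then show ?thesis
    by (simp add: sum_divide_distrib)
qed

lemma row_integral_if_minor_k:
  assumes "\<bar>minor a r\<bar> = real k" "\<And>i. a (r i) \<bullet> x \<in> \<int>"
  shows "row_integral x"
  unfolding row_integral_def
proof
  fix l
  have r: "minor a r = real k \<or> minor a r = - real k" using assms(1) by linarith
  then have "minor a r \<noteq> 0" using k_pos by auto
  moreover have "minor a (r(p := l)) / minor a r \<in> \<int>" for p
    using minor_cases[of "r(p := l)"] r k_pos by auto
  ultimately show "a l \<bullet> x \<in> \<int>"
    using assms(2) by (subst row_expansion) (auto simp only: intro!: Ints_sum Ints_mult)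
qed

lemma twice_row_Ints:
  assumes "minor a r \<noteq> 0" "\<And>i. a (r i) \<bullet> x \<in> \<int>"
  shows "2 * (a l \<bullet> x) \<in> \<int>"
proof -
  have "2 * (minor a (r(p := l)) / minor a r) \<in> \<int>" for p
    using minor_cases[of "r(p := l)"] minor_cases[of r] assms(1) k_pos by auto
  then have "(\<Sum>p\<in>UNIV. 2 * (minor a (r(p := l)) / minor a r) * (a (r p) \<bullet> x)) \<in> \<int>"
    using assms(2) by (intro Ints_sum Ints_mult[of "2 * _"])
  then show ?thesis
    by (subst row_expansion[OF assms(1)]) (simp add: sum_distrib_left mult.assoc)
qed

text \<open>A nonintegral row product forces a nonintegral ratio of minors, and the only such ratios
  are k over 2k up to sign.\<close>

lemma exchange_to_minor_k:
  assumes "minor a r \<noteq> 0" "\<And>i. a (r i) \<bullet> x \<in> \<int>" "\<not> row_integral x"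
  obtains p l where "\<bar>minor a r\<bar> = 2 * real k" "\<bar>minor a (r(p := l))\<bar> = real k" "a l \<bullet> x \<notin> \<int>"
proof -
  obtain l where l: "a l \<bullet> x \<notin> \<int>"
    using assms(3) by (auto simp: row_integral_def)
  obtain p where p: "minor a (r(p := l)) / minor a r \<notin> \<int>"
  proof (rule ccontr)
    assume "\<not> thesis"
    then have "minor a (r(p := l)) / minor a r \<in> \<int>" for p using that by blast
    then have "(\<Sum>p\<in>UNIV. (minor a (r(p := l)) / minor a r) * (a (r p) \<bullet> x)) \<in> \<int>"
      using assms(2) by (intro Ints_sum Ints_mult)
    then show False using l row_expansion[OF assms(1)] by metis
  qed
  have "\<bar>minor a r\<bar> = 2 * real k \<and> \<bar>minor a (r(p := l))\<bar> = real k"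
    using p minor_cases[of "r(p := l)"] minor_cases[of r] assms(1) k_pos by auto
  then show thesis using that l by blast
qed

text \<open>Exchanging a single row makes the minor \<open>\<plusminus>k\<close>, so that this one row decides
  membership in the lattice; hence the vectors integral on the rows \<open>r\<close> form at most two cosets of it.\<close>

lemma row_integral_add_of_nonintegral:
  assumes "minor a r \<noteq> 0" "\<And>i. a (r i) \<bullet> x \<in> \<int>" "\<And>i. a (r i) \<bullet> h \<in> \<int>"
    "\<not> row_integral x" "\<not> row_integral h"
  shows "row_integral (x + h)"
proof -
  obtain p l where pl: "\<bar>minor a (r(p := l))\<bar> = real k" "a l \<bullet> x \<notin> \<int>"
    using exchange_to_minor_k[OF assms(1,2,4)] by metis
  have "a l \<bullet> h \<notin> \<int>"
  proof
    assume "a l \<bullet> h \<in> \<int>"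
    then have "row_integral h"
      using assms(3) by (intro row_integral_if_minor_k[OF pl(1)]) auto
    then show False using assms(5) by simp
  qed
  then have "a l \<bullet> x + a l \<bullet> h \<in> \<int>"
    using pl(2) assms by (intro half_integers_add_Ints twice_row_Ints[of r]) auto
  then show ?thesis
    using assms(2,3) by (intro row_integral_if_minor_k[OF pl(1)]) (auto simp: inner_add_right)
qed

lemma row_half_step:
  assumes "h \<in> half_steps"
  shows "a j \<bullet> h \<in> {0, 1/2, -1/2, 1, -1}"
proof -
  obtain s r p where "h = (s / (2 * real k)) *\<^sub>R cofactor_vec a r p" "s = 1 \<or> s = -1"
    using assms by (auto simp: half_steps_def)
  then show ?thesis
    using minor_cases[of "r(p := j)"] k_pos by (auto simp: row_inner_cofactor_vec)
qed

lemma half_step_bound: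
  assumes "h \<in> half_steps" "step_bound f \<beta>"
  shows "\<bar>f \<bullet> h\<bar> \<le> \<beta> / (2 * real k)"
proof -
  obtain s r p where h: "h = (s / (2 * real k)) *\<^sub>R cofactor_vec a r p" "s = 1 \<or> s = -1"
    using assms by (auto simp: half_steps_def)
  have "\<bar>f \<bullet> h\<bar> = \<bar>f \<bullet> cofactor_vec a r p\<bar> / (2 * real k)"
    using h by (auto simp: abs_mult)
  also have "\<dots> \<le> \<beta> / (2 * real k)"
    using assms(2) k_pos by (intro divide_right_mono) (auto simp: step_bound_def)
  finally show ?thesis .
qed

text \<open>Besides the signs, the size of each row product is recorded as a minor: a value 1/2
  reveals an exchange leading to a minor of absolute value k.\<close>

lemma ex_conformal_half_step:
  assumes T: "spanning_rows a T" and "d \<noteq> 0"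
  obtains h r p where "h \<in> half_steps" "range r \<subseteq> T" "minor a r \<noteq> 0"
    "\<forall>j. \<bar>a j \<bullet> h\<bar> = \<bar>minor a (r(p := j))\<bar> / (2 * real k)"
    "\<forall>j\<in>T. a j \<bullet> d \<ge> 0 \<longrightarrow> a j \<bullet> h \<ge> 0" "\<forall>j\<in>T. a j \<bullet> d \<le> 0 \<longrightarrow> a j \<bullet> h \<le> 0"
proof -
  obtain r p s where r: "range r \<subseteq> T" "minor a r \<noteq> 0" "s = 1 \<or> s = (-1::real)"
    "\<forall>j\<in>T. a j \<bullet> d \<ge> 0 \<longrightarrow> a j \<bullet> (s *\<^sub>R cofactor_vec a r p) \<ge> 0"
    "\<forall>j\<in>T. a j \<bullet> d \<le> 0 \<longrightarrow> a j \<bullet> (s *\<^sub>R cofactor_vec a r p) \<le> 0"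
    using assms by (rule ex_conformal_cofactor_vec)
  define h where "h = (s / (2 * real k)) *\<^sub>R cofactor_vec a r p"
  have h: "a j \<bullet> h = (a j \<bullet> (s *\<^sub>R cofactor_vec a r p)) / (2 * real k)" for j
    by (simp add: h_def)
  have "h \<in> half_steps" unfolding half_steps_def h_def using r(3) by blast
  moreover have "\<forall>j. \<bar>a j \<bullet> h\<bar> = \<bar>minor a (r(p := j))\<bar> / (2 * real k)"
    using r(3) by (auto simp: h row_inner_cofactor_vec abs_mult)
  moreover have "\<forall>j\<in>T. a j \<bullet> d \<ge> 0 \<longrightarrow> a j \<bullet> h \<ge> 0" "\<forall>j\<in>T. a j \<bullet> d \<le> 0 \<longrightarrow> a j \<bullet> h \<le> 0"
    unfolding h using r(4,5) k_pos by (simp_all add: divide_le_0_iff)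
  ultimately show thesis
    using that r(1,2) by blast
qed

text \<open>Induction on the distance from \<open>x\<close> to \<open>x + d\<close>, measured on
  \<open>T\<close>. A conformal half step \<open>h\<close> is integral on \<open>T\<close>, so by
  the two-coset property either it leads from \<open>x\<close> into the lattice or it belongs to the
  lattice itself; in the latter case \<open>d - h\<close> replaces \<open>d\<close>.\<close>

lemma half_step_toward_aux:
  assumes x: "\<not> row_integral x" and T: "spanning_rows a T" "\<And>j. j \<in> T \<Longrightarrow> a j \<bullet> x \<in> \<int>"
  shows "row_integral (x + d) \<Longrightarrow> (\<Sum>j\<in>T. \<bar>a j \<bullet> d\<bar>) \<le> real N \<Longrightarrow>
    \<exists>h\<in>half_steps. row_integral (x + h) \<and> (\<forall>j\<in>T. conformal (a j \<bullet> h) (a j \<bullet> d))"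
proof (induction N arbitrary: d)
  case 0
  then have "(\<Sum>j\<in>T. \<bar>a j \<bullet> d\<bar>) = 0"
    by (intro order_antisym sum_nonneg) auto
  then have "\<forall>j\<in>T. a j \<bullet> d = 0"
    by (subst (asm) sum_nonneg_eq_0_iff) auto
  then have "d = 0" using T(1) by (simp add: spanning_rows_def)
  then show ?case using x 0 by simp
next
  case (Suc N)
  have "d \<noteq> 0" using x Suc.prems(1) by auto
  then obtain h r p where h: "h \<in> half_steps" "range r \<subseteq> T" "minor a r \<noteq> 0"
    "\<forall>j. \<bar>a j \<bullet> h\<bar> = \<bar>minor a (r(p := j))\<bar> / (2 * real k)"
    "\<forall>j\<in>T. a j \<bullet> d \<ge> 0 \<longrightarrow> a j \<bullet> h \<ge> 0" "\<forall>j\<in>T. a j \<bullet> d \<le> 0 \<longrightarrow> a j \<bullet> h \<le> 0"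
    by (rule ex_conformal_half_step[OF T(1)])
  \<comment> \<open>A value 1/2 on \<open>T\<close> would yield rows of \<open>T\<close> with minor
    k in absolute value; \<open>x\<close> is integral on them, so it would be in the
    lattice.\<close>
  have h01: "a j \<bullet> h \<in> {0, 1, -1}" if "j \<in> T" for j
  proof -
    have "\<bar>minor a (r(p := j))\<bar> \<noteq> real k"
    proof
      assume "\<bar>minor a (r(p := j))\<bar> = real k"
      then have "row_integral x"
        using h(2) that T(2) by (rule_tac row_integral_if_minor_k[of "r(p := j)"]) auto
      then show False using x by simp
    qed
    then have "\<bar>a j \<bullet> h\<bar> \<noteq> 1/2" using h(4) k_pos by simp
    then show ?thesis using row_half_step[OF h(1), of j] by auto
  qed
  have dint: "a j \<bullet> d \<in> \<int>" if "j \<in> T" for j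
  proof -
    have "a j \<bullet> (x + d) - a j \<bullet> x \<in> \<int>"
      using Suc.prems(1) T(2)[OF that] by (intro Ints_diff) (auto simp: row_integral_def)
    then show ?thesis by (simp add: inner_add_right)
  qed
  have conf: "conformal (a j \<bullet> h) (a j \<bullet> d)" if "j \<in> T" for j
  proof (cases "a j \<bullet> d = 0")
    case True
    then have "a j \<bullet> h = 0" using h(5,6) that by (intro order_antisym) auto
    then show ?thesis using True by (simp add: conformal_def)
  next
    case False
    then have d1: "\<bar>a j \<bullet> d\<bar> \<ge> 1" using dint[OF that] Ints_nonzero_abs_ge1 by blast
    have h1: "\<bar>a j \<bullet> h\<bar> \<le> 1" using h01[OF that] by auto
    show ?thesis
    proof (cases "a j \<bullet> d \<ge> 0")
      case True
      then have "a j \<bullet> h \<ge> 0" using h(5) that by blast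
      then show ?thesis using True d1 h1 by (simp add: conformal_def)
    next
      case False
      then have "a j \<bullet> h \<le> 0" using h(6) that by simp
      then show ?thesis using False d1 h1 by (simp add: conformal_def)
    qed
  qed
  have rT: "r i \<in> T" for i using h(2) by blast
  have hint: "a j \<bullet> h \<in> \<int>" if "j \<in> T" for j using h01[OF that] by auto
  show ?case
  proof (cases "row_integral h")
    case False
    then have "row_integral (x + h)"
      using x T(2)[OF rT] hint[OF rT] by (intro row_integral_add_of_nonintegral[OF h(3)]) auto
    then show ?thesis using h(1) conf by blast
  next
    case True
    have "row_integral (x + (d - h))"
      using row_integral_diff[OF Suc.prems(1) True] by (simp add: add_diff_eq)
    moreover have "(\<Sum>j\<in>T. \<bar>a j \<bullet> (d - h)\<bar>) \<le> real N"
    proof -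
      \<comment> \<open>On row \<open>r p\<close> the half step takes the value
        \<open>minor a r\<close> over 2k up to sign, nonzero and hence a full unit, so the distance
        drops by at least 1.\<close>
      have "\<bar>a (r p) \<bullet> h\<bar> \<noteq> 0" using h(3,4) k_pos by (simp add: fun_upd_idem)
      then have "\<bar>a (r p) \<bullet> h\<bar> = 1" using h01[OF rT[of p]] by auto
      then have "1 \<le> (\<Sum>j\<in>T. \<bar>a j \<bullet> h\<bar>)"
        using member_le_sum[of "r p" T "\<lambda>j. \<bar>a j \<bullet> h\<bar>"] rT by simp
      moreover have "(\<Sum>j\<in>T. \<bar>a j \<bullet> (d - h)\<bar>) = (\<Sum>j\<in>T. \<bar>a j \<bullet> d\<bar>) - (\<Sum>j\<in>T. \<bar>a j \<bullet> h\<bar>)"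
        using conf by (auto simp: inner_diff_right conformal_abs_diff sum_subtractf[symmetric] intro!: sum.cong)
      ultimately show ?thesis using Suc.prems(2) by simp
    qed
    ultimately obtain h' where h': "h' \<in> half_steps" "row_integral (x + h')"
      "\<forall>j\<in>T. conformal (a j \<bullet> h') (a j \<bullet> (d - h))"
      using Suc.IH by blast
    moreover have "conformal (a j \<bullet> h') (a j \<bullet> d)" if "j \<in> T" for j
      using h'(3) conformal_diff[OF conf[OF that]] that by (auto simp: inner_diff_right intro: conformal_trans)
    ultimately show ?thesis by blast
  qed
qed

text \<open>Rows integral at \<open>x\<close> are controlled by conformality. On any other row a
  half step moves by at most 1, and as \<open>x + h\<close> is integral there, it cannot pass an
  integer lying strictly beyond \<open>x\<close>.\<close>

lemma half_step_toward:
  assumes x: "\<not> row_integral x" and T: "spanning_rows a {j. a j \<bullet> x \<in> \<int>}" and z: "row_integral z"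
  obtains h where "h \<in> half_steps" "row_integral (x + h)"
    "\<forall>j. a j \<bullet> x \<in> \<int> \<longrightarrow> conformal (a j \<bullet> h) (a j \<bullet> (z - x))"
    "\<forall>j. \<forall>m\<in>\<int>. a j \<bullet> x \<le> m \<longrightarrow> a j \<bullet> z \<le> m \<longrightarrow> a j \<bullet> (x + h) \<le> m"
    "\<forall>j. \<forall>m\<in>\<int>. a j \<bullet> x \<ge> m \<longrightarrow> a j \<bullet> z \<ge> m \<longrightarrow> a j \<bullet> (x + h) \<ge> m"
proof -
  define T where "T = {j. a j \<bullet> x \<in> \<int>}"
  obtain N where "(\<Sum>j\<in>T. \<bar>a j \<bullet> (z - x)\<bar>) \<le> real N"
    using real_arch_simple by blast
  moreover have "spanning_rows a T" "\<And>j. j \<in> T \<Longrightarrow> a j \<bullet> x \<in> \<int>" "row_integral (x + (z - x))"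
    using assms(2) z by (simp_all add: T_def)
  ultimately have "\<exists>h\<in>half_steps. row_integral (x + h) \<and> (\<forall>j\<in>T. conformal (a j \<bullet> h) (a j \<bullet> (z - x)))"
    by (intro half_step_toward_aux[OF x])
  then obtain h where h: "h \<in> half_steps" "row_integral (x + h)"
    "\<forall>j\<in>T. conformal (a j \<bullet> h) (a j \<bullet> (z - x))"
    by blast
  have lt1: "\<bar>a j \<bullet> h\<bar> \<le> 1" for j
    using row_half_step[OF h(1), of j] by auto
  have int: "a j \<bullet> (x + h) \<in> \<int>" for j
    using h(2) by (simp add: row_integral_def)
  have up: "a j \<bullet> (x + h) \<le> m" if "m \<in> \<int>" "a j \<bullet> x \<le> m" "a j \<bullet> z \<le> m" for j m
  proof (cases "a j \<bullet> x \<in> \<int>")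
    case True
    then have "conformal (a j \<bullet> h) (a j \<bullet> (z - x))" using h(3) by (simp add: T_def)
    then show ?thesis using that by (auto simp: conformal_def inner_add_right inner_diff_right)
  next
    case False
    then have "a j \<bullet> x < m" using that by (cases "a j \<bullet> x = m") auto
    then have "a j \<bullet> (x + h) < m + 1" using lt1[of j] by (simp add: inner_add_right)
    then show ?thesis using int[of j] that(1) Ints_less_add_1 by blast
  qed
  have low: "a j \<bullet> (x + h) \<ge> m" if "m \<in> \<int>" "a j \<bullet> x \<ge> m" "a j \<bullet> z \<ge> m" for j m
  proof (cases "a j \<bullet> x \<in> \<int>")
    case True
    then have "conformal (a j \<bullet> h) (a j \<bullet> (z - x))" using h(3) by (simp add: T_def)
    then show ?thesis using that by (auto simp: conformal_def inner_add_right inner_diff_right)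
  next
    case False
    then have "a j \<bullet> x > m" using that by (cases "a j \<bullet> x = m") auto
    then have "m < a j \<bullet> (x + h) + 1" using lt1[of j] by (simp add: inner_add_right)
    then show ?thesis using int[of j] that(1) Ints_less_add_1 by blast
  qed
  show thesis
    by (rule that[OF h(1,2)]) (use h(3) up low in \<open>auto simp: T_def\<close>)
qed

end

lemma conformal_sum:
  fixes x :: "'b \<Rightarrow> real"
  assumes "finite B" "S \<subseteq> B" "\<forall>t\<in>B. conformal (x t) D"
  shows "conformal (sum x S) (sum x B)"
proof (cases "D \<ge> 0")
  case True
  then have "\<forall>t\<in>B. x t \<ge> 0" using assms(3) by (auto simp: conformal_def)
  then show ?thesis
    unfolding conformal_def using assms(1,2) by (intro disjI1 conjI sum_nonneg sum_mono2) auto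
next
  case False
  then have neg: "\<forall>t\<in>B. x t \<le> 0" using assms(3) by (auto simp: conformal_def)
  have "sum (\<lambda>t. - x t) S \<le> sum (\<lambda>t. - x t) B"
    using neg assms(1,2) by (intro sum_mono2) auto
  moreover have "sum x S \<le> 0" using neg assms(2) by (intro sum_nonpos) auto
  ultimately show ?thesis
    by (simp add: conformal_def sum_negf)
qed

section \<open>Slabs and their extreme points\<close>

lemma ex_small_multiplier:
  fixes s t :: "'m::finite \<Rightarrow> real"
  assumes "\<And>j. s j > 0"
  obtains \<epsilon> where "\<epsilon> > 0" "\<forall>j. \<bar>\<epsilon> * t j\<bar> \<le> s j"
proof -
  define \<epsilon> where "\<epsilon> = Min (range (\<lambda>j. s j / (1 + \<bar>t j\<bar>)))"
  have "\<epsilon> > 0"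
    unfolding \<epsilon>_def using assms by (subst Min_gr_iff) (auto intro!: divide_pos_pos add_pos_nonneg)
  moreover have "\<bar>\<epsilon> * t j\<bar> \<le> s j" for j
  proof -
    have "\<epsilon> \<le> s j / (1 + \<bar>t j\<bar>)"
      unfolding \<epsilon>_def by (intro Min_le) auto
    then have "\<epsilon> * (1 + \<bar>t j\<bar>) \<le> s j"
      by (simp add: pos_le_divide_eq add_pos_nonneg)
    then show ?thesis
      using \<open>\<epsilon> > 0\<close> by (simp add: abs_mult distrib_left)
  qed
  ultimately show thesis using that by blast
qed

text \<open>Bounds on both sides give compactness even where the polyhedron of the theorem is
  unbounded; integral bounds make the products of tight rows integral.\<close>

definition slab :: "('m \<Rightarrow> real^'n) \<Rightarrow> ('m \<Rightarrow> int) \<Rightarrow> ('m \<Rightarrow> int) \<Rightarrow> (real^'n) set" where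
  "slab a l u = {y. \<forall>j. of_int (l j) \<le> a j \<bullet> y \<and> a j \<bullet> y \<le> of_int (u j)}"

definition tight_rows :: "('m \<Rightarrow> real^'n) \<Rightarrow> ('m \<Rightarrow> int) \<Rightarrow> ('m \<Rightarrow> int) \<Rightarrow> real^'n \<Rightarrow> 'm set" where
  "tight_rows a l u x = {j. a j \<bullet> x = of_int (l j) \<or> a j \<bullet> x = of_int (u j)}"

lemma slab_feasible_direction:
  fixes a :: "'m::finite \<Rightarrow> real^'n"
  assumes "x \<in> slab a l u"
    and "\<And>j. a j \<bullet> x = of_int (l j) \<Longrightarrow> a j \<bullet> w \<ge> 0"
    and "\<And>j. a j \<bullet> x = of_int (u j) \<Longrightarrow> a j \<bullet> w \<le> 0"
  obtains \<epsilon> where "\<epsilon> > 0" "x + \<epsilon> *\<^sub>R w \<in> slab a l u"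
proof -
  \<comment> \<open>On a tight side the slack 0 is replaced by the dummy 1 to keep \<open>s\<close>
    positive; there the sign hypotheses on \<open>w\<close> take over.\<close>
  define s where "s = (\<lambda>j. min (if a j \<bullet> x = of_int (l j) then 1 else a j \<bullet> x - of_int (l j))
      (if a j \<bullet> x = of_int (u j) then 1 else of_int (u j) - a j \<bullet> x))"
  have x: "of_int (l j) \<le> a j \<bullet> x" "a j \<bullet> x \<le> of_int (u j)" for j
    using assms(1) by (auto simp: slab_def)
  have "s j > 0" for j
    using x[of j] by (auto simp: s_def order_le_less)
  then obtain \<epsilon> where \<epsilon>: "\<epsilon> > 0" "\<forall>j. \<bar>\<epsilon> * (a j \<bullet> w)\<bar> \<le> s j"
    by (rule ex_small_multiplier[of s "\<lambda>j. a j \<bullet> w"])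
  have "of_int (l j) \<le> a j \<bullet> x + \<epsilon> * (a j \<bullet> w)" for j
  proof (cases "a j \<bullet> x = of_int (l j)")
    case True
    then show ?thesis using assms(2)[of j] \<epsilon>(1) by simp
  next
    case False
    then have "s j \<le> a j \<bullet> x - of_int (l j)" by (simp add: s_def)
    then show ?thesis using spec[OF \<epsilon>(2), of j] by linarith
  qed
  moreover have "a j \<bullet> x + \<epsilon> * (a j \<bullet> w) \<le> of_int (u j)" for j
  proof (cases "a j \<bullet> x = of_int (u j)")
    case True
    then show ?thesis using assms(3)[of j] \<epsilon>(1) by (simp add: mult_nonneg_nonpos)
  next
    case False
    then have "s j \<le> of_int (u j) - a j \<bullet> x" by (simp add: s_def)
    then show ?thesis using spec[OF \<epsilon>(2), of j] by linarith
  qed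
  ultimately have "x + \<epsilon> *\<^sub>R w \<in> slab a l u"
    by (simp add: slab_def inner_add_right)
  then show thesis using that \<epsilon>(1) by blast
qed

lemma convex_slab: "convex (slab a l u)"
proof -
  have "slab a l u = (\<Inter>j. {y. a j \<bullet> y \<ge> of_int (l j)} \<inter> {y. a j \<bullet> y \<le> of_int (u j)})"
    by (auto simp: slab_def)
  then show ?thesis
    by (simp add: convex_INT convex_Int convex_halfspace_ge convex_halfspace_le)
qed

text \<open>A nonzero direction orthogonal to all tight rows could be followed both forwards and
  backwards, putting \<open>x\<close> inside a segment of the slab.\<close>

lemma extreme_point_spanning_tight_rows:
  fixes a :: "'m::finite \<Rightarrow> real^'n"
  assumes "x extreme_point_of slab a l u"
  shows "spanning_rows a (tight_rows a l u x)"
  unfolding spanning_rows_def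
proof (intro allI impI, rule ccontr)
  fix w assume w: "\<forall>j\<in>tight_rows a l u x. a j \<bullet> w = 0" "w \<noteq> 0"
  have x: "x \<in> slab a l u" using assms by (simp add: extreme_point_of_def)
  obtain \<epsilon> where \<epsilon>: "\<epsilon> > 0" "x + \<epsilon> *\<^sub>R w \<in> slab a l u"
    by (rule slab_feasible_direction[OF x, of w]) (use w in \<open>auto simp: tight_rows_def\<close>)
  obtain \<delta> where \<delta>: "\<delta> > 0" "x + \<delta> *\<^sub>R (- w) \<in> slab a l u"
    by (rule slab_feasible_direction[OF x, of "- w"]) (use w in \<open>auto simp: tight_rows_def\<close>)
  define \<theta> where "\<theta> = \<epsilon> / (\<epsilon> + \<delta>)"
  have "x \<in> open_segment (x + \<epsilon> *\<^sub>R w) (x + \<delta> *\<^sub>R (- w))"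
    unfolding in_segment
  proof (intro conjI exI[of _ \<theta>])
    show "0 < \<theta>" "\<theta> < 1" using \<epsilon>(1) \<delta>(1) by (auto simp: \<theta>_def)
    have "(\<epsilon> + \<delta>) *\<^sub>R w \<noteq> 0" using \<epsilon>(1) \<delta>(1) w(2) by simp
    then show "x + \<epsilon> *\<^sub>R w \<noteq> x + \<delta> *\<^sub>R (- w)"
      by (simp add: scaleR_add_left add_eq_0_iff2)
    have "(1 - \<theta>) * \<epsilon> - \<theta> * \<delta> = 0" using \<epsilon>(1) \<delta>(1) by (simp add: \<theta>_def field_simps)
    moreover have "(1 - \<theta>) *\<^sub>R (x + \<epsilon> *\<^sub>R w) + \<theta> *\<^sub>R (x + \<delta> *\<^sub>R (- w)) = x + ((1 - \<theta>) * \<epsilon> - \<theta> * \<delta>) *\<^sub>R w"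
      by (simp add: algebra_simps)
    ultimately show "x = (1 - \<theta>) *\<^sub>R (x + \<epsilon> *\<^sub>R w) + \<theta> *\<^sub>R (x + \<delta> *\<^sub>R (- w))"
      by simp
  qed
  then show False
    using assms \<epsilon>(2) \<delta>(2) by (auto simp: extreme_point_of_def)
qed

section \<open>Decomposition into conformal lattice steps\<close>

context two_modular
begin

lemma step_bound_nonneg: "step_bound f \<beta> \<Longrightarrow> \<beta> \<ge> 0"
  unfolding step_bound_def using abs_ge_zero order_trans by blast

text \<open>Walk along an extreme ray of the conformal cone of \<open>d\<close>. If the walk gets blocked after a half step outside
  the lattice, a second half step leads back into the lattice.\<close>

lemma ex_conformal_lattice_step:
  assumes d: "row_integral d" "d \<noteq> 0"
  obtains e where "e \<noteq> 0" "row_integral e" "\<forall>j. conformal (a j \<bullet> e) (a j \<bullet> d)"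
    "\<forall>f \<beta>. step_bound f \<beta> \<longrightarrow> \<bar>f \<bullet> e\<bar> \<le> \<beta> / real k"
proof -
  obtain h r p where h: "h \<in> half_steps" "range r \<subseteq> UNIV" "minor a r \<noteq> 0"
    "\<forall>j. \<bar>a j \<bullet> h\<bar> = \<bar>minor a (r(p := j))\<bar> / (2 * real k)"
    "\<forall>j\<in>UNIV. a j \<bullet> d \<ge> 0 \<longrightarrow> a j \<bullet> h \<ge> 0" "\<forall>j\<in>UNIV. a j \<bullet> d \<le> 0 \<longrightarrow> a j \<bullet> h \<le> 0"
    by (rule ex_conformal_half_step[OF spanning_UNIV d(2)])
  have "\<bar>a (r p) \<bullet> h\<bar> \<noteq> 0" using h(3,4) k_pos by (simp add: fun_upd_idem)
  then have h0: "h \<noteq> 0" by auto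
  have dint: "a j \<bullet> d \<in> \<int>" for j using d(1) by (simp add: row_integral_def)
  have d1: "\<bar>a j \<bullet> d\<bar> \<ge> 1" if "a j \<bullet> d \<noteq> 0" for j
    using dint Ints_nonzero_abs_ge1 that by blast
  have h1: "\<bar>a j \<bullet> h\<bar> \<le> 1" for j using row_half_step[OF h(1), of j] by auto
  have hz: "a j \<bullet> h = 0" if "a j \<bullet> d = 0" for j
    using h(5,6) that by (intro order_antisym) auto
  have confI: "conformal (a j \<bullet> (c *\<^sub>R h)) (a j \<bullet> d)" if "c \<ge> 0" "c * \<bar>a j \<bullet> h\<bar> \<le> \<bar>a j \<bullet> d\<bar>" for c j
  proof (cases "a j \<bullet> d \<ge> 0")
    case True
    then have "a j \<bullet> h \<ge> 0" using h(5) by blast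
    then show ?thesis using True that by (simp add: conformal_def)
  next
    case False
    then have "a j \<bullet> h \<le> 0" using h(6) by simp
    moreover then have "c * (a j \<bullet> h) \<le> 0" using that(1) by (simp add: mult_nonneg_nonpos)
    ultimately show ?thesis using False that by (simp add: conformal_def)
  qed
  have hconf: "conformal (a j \<bullet> h) (a j \<bullet> d)" for j
    using confI[of 1 j] h1[of j] d1[of j] hz[of j] by (cases "a j \<bullet> d = 0") auto
  have hb: "\<bar>f \<bullet> h\<bar> \<le> \<beta> / (2 * real k)" if "step_bound f \<beta>" for f \<beta>
    using half_step_bound h(1) that by blast
  have halves: "\<beta> / (2 * real k) + \<beta> / (2 * real k) = \<beta> / real k" for \<beta>
    using k_pos by (simp add: field_simps)
  \<comment> \<open>Either the whole edge direction stays conformal, or its half is a lattice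
    vector, or some row blocks the second half while the first is outside the lattice.\<close>
  consider (full) "\<forall>j. 2 * \<bar>a j \<bullet> h\<bar> \<le> \<bar>a j \<bullet> d\<bar>" | (half) "row_integral h"
    | (blocked) j1 where "2 * \<bar>a j1 \<bullet> h\<bar> > \<bar>a j1 \<bullet> d\<bar>" "\<not> row_integral h"
    by (meson not_le)
  then show thesis
  proof cases
    case full
    show thesis
    proof (rule that[of "2 *\<^sub>R h"])
      show "row_integral (2 *\<^sub>R h)"
        unfolding row_integral_def
      proof
        fix j
        have "a j \<bullet> 2 *\<^sub>R h \<in> {0, 1, -1, 2, -2}" using row_half_step[OF h(1), of j] by auto
        then show "a j \<bullet> 2 *\<^sub>R h \<in> \<int>" by auto
      qed
      show "\<forall>j. conformal (a j \<bullet> (2 *\<^sub>R h)) (a j \<bullet> d)" using confI[of 2] full by simp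
      show "\<forall>f \<beta>. step_bound f \<beta> \<longrightarrow> \<bar>f \<bullet> 2 *\<^sub>R h\<bar> \<le> \<beta> / real k"
      proof (intro allI impI)
        fix f \<beta> assume "step_bound f \<beta>"
        then show "\<bar>f \<bullet> 2 *\<^sub>R h\<bar> \<le> \<beta> / real k"
          using hb[of f \<beta>] halves[of \<beta>] by (simp add: abs_mult)
      qed
    qed (use h0 in simp)
  next
    case half
    show thesis
    proof (rule that[of h])
      show "\<forall>f \<beta>. step_bound f \<beta> \<longrightarrow> \<bar>f \<bullet> h\<bar> \<le> \<beta> / real k"
      proof (intro allI impI)
        fix f \<beta> assume b: "step_bound f \<beta>"
        then have "\<beta> / (2 * real k) \<ge> 0" using step_bound_nonneg by simp
        then show "\<bar>f \<bullet> h\<bar> \<le> \<beta> / real k" using hb[OF b] halves[of \<beta>] by linarith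
      qed
    qed (use h0 half hconf in auto)
  next
    case blocked
    \<comment> \<open>Row \<open>j1\<close> is already finished: in absolute value, \<open>h\<close>
      changes it by more than 1/2, hence by 1, and \<open>d\<close> by a nonzero integer below 2,
      hence by 1 too.\<close>
    have "a j1 \<bullet> d \<noteq> 0" using hz[of j1] blocked(1) by auto
    then have "\<bar>a j1 \<bullet> d\<bar> \<ge> 1" by (rule d1)
    then have hj: "\<bar>a j1 \<bullet> h\<bar> = 1"
      using blocked(1) row_half_step[OF h(1), of j1] by auto
    have "a j1 \<bullet> d \<in> \<int>" by (rule dint)
    then have "\<bar>a j1 \<bullet> d\<bar> \<le> 1"
      using blocked(1) hj by (intro Ints_less_add_1) auto
    then have hd: "a j1 \<bullet> d = a j1 \<bullet> h"
      using hj hconf[of j1] by (auto simp: conformal_def)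
    \<comment> \<open>Exchanging \<open>r p\<close> for \<open>j1\<close> gives independent rows
      that are all integral at \<open>h\<close>, as needed for a half step from \<open>h\<close>
      toward \<open>d\<close>.\<close>
    have "minor a (r(p := j1)) \<noteq> 0" using hj h(4) by auto
    moreover have "range (r(p := j1)) \<subseteq> {j. a j \<bullet> h \<in> \<int>}"
    proof -
      have "a (r i) \<bullet> h \<in> \<int>" if "i \<noteq> p" for i
      proof -
        have "\<not> inj (r(p := r i))" using injD[of "r(p := r i)" p i] that by auto
        then have "\<bar>a (r i) \<bullet> h\<bar> = 0" using h(4) by (simp add: minor_eq_0_if_not_inj)
        then show ?thesis by simp
      qed
      moreover have "a j1 \<bullet> h \<in> \<int>" using hd dint[of j1] by simp
      ultimately show ?thesis by auto
    qed
    ultimately have "spanning_rows a {j. a j \<bullet> h \<in> \<int>}" by (rule minor_nz_spanning_rows)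
    then obtain h' where h': "h' \<in> half_steps" "row_integral (h + h')"
      "\<forall>j. a j \<bullet> h \<in> \<int> \<longrightarrow> conformal (a j \<bullet> h') (a j \<bullet> (d - h))"
      "\<forall>j. \<forall>m\<in>\<int>. a j \<bullet> h \<le> m \<longrightarrow> a j \<bullet> d \<le> m \<longrightarrow> a j \<bullet> (h + h') \<le> m"
      "\<forall>j. \<forall>m\<in>\<int>. a j \<bullet> h \<ge> m \<longrightarrow> a j \<bullet> d \<ge> m \<longrightarrow> a j \<bullet> (h + h') \<ge> m"
      by (rule half_step_toward[OF blocked(2) _ d(1)])
    show thesis
    proof (rule that[of "h + h'"])
      \<comment> \<open>Since \<open>h\<close> and \<open>d\<close> agree on row \<open>j1\<close>,
        the second half step leaves it fixed, so the sum cannot vanish.\<close>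
      have "conformal (a j1 \<bullet> h') (a j1 \<bullet> (d - h))"
        using h'(3) hd dint[of j1] by simp
      then have "a j1 \<bullet> h' = 0" using hd by (auto simp: conformal_def inner_diff_right)
      then have "a j1 \<bullet> (h + h') \<noteq> 0" using hj by (auto simp: inner_add_right)
      then show "h + h' \<noteq> 0" by auto
      show "row_integral (h + h')" by (rule h'(2))
      show "\<forall>j. conformal (a j \<bullet> (h + h')) (a j \<bullet> d)"
      proof
        fix j
        show "conformal (a j \<bullet> (h + h')) (a j \<bullet> d)"
        proof (cases "a j \<bullet> d \<ge> 0")
          case True
          then have "0 \<le> a j \<bullet> h" "a j \<bullet> h \<le> a j \<bullet> d" using hconf[of j] by (auto simp: conformal_def)
          then show ?thesis
            unfolding conformal_def using h'(4,5) True dint[of j] by (intro disjI1) auto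
        next
          case False
          then have "0 \<ge> a j \<bullet> h" "a j \<bullet> h \<ge> a j \<bullet> d" using hconf[of j] by (auto simp: conformal_def)
          then show ?thesis
            unfolding conformal_def using h'(4,5) False dint[of j] by (intro disjI2) auto
        qed
      qed
      show "\<forall>f \<beta>. step_bound f \<beta> \<longrightarrow> \<bar>f \<bullet> (h + h')\<bar> \<le> \<beta> / real k"
      proof (intro allI impI)
        fix f \<beta> assume b: "step_bound f \<beta>"
        then show "\<bar>f \<bullet> (h + h')\<bar> \<le> \<beta> / real k"
          using hb[OF b] half_step_bound[OF h'(1) b] halves[of \<beta>] by (simp add: inner_add_right)
      qed
    qed
  qed
qed

text \<open>Conformal lattice steps are split off greedily; each nonzero one uses up at least one
  unit of the sum of absolute row products.\<close>

lemma conformal_decomposition: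
  "row_integral d \<Longrightarrow> (\<Sum>j\<in>UNIV. \<bar>a j \<bullet> d\<bar>) \<le> real N \<Longrightarrow>
    \<exists>M e. d = (\<Sum>t<M. e t) \<and> (\<forall>t<(M::nat). e t \<noteq> 0 \<and> row_integral (e t) \<and>
      (\<forall>j. conformal (a j \<bullet> e t) (a j \<bullet> d)) \<and>
      (\<forall>f \<beta>. step_bound f \<beta> \<longrightarrow> \<bar>f \<bullet> e t\<bar> \<le> \<beta> / real k))"
proof (induction N arbitrary: d)
  case 0
  then have "(\<Sum>j\<in>UNIV. \<bar>a j \<bullet> d\<bar>) = 0"
    by (intro order_antisym sum_nonneg) auto
  then have "\<forall>j\<in>UNIV. a j \<bullet> d = 0"
    by (subst (asm) sum_nonneg_eq_0_iff) auto
  then have "d = 0" using spanning_UNIV by (simp add: spanning_rows_def)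
  then show ?case by (intro exI[of _ 0]) auto
next
  case (Suc N)
  show ?case
  proof (cases "d = 0")
    case True
    then show ?thesis by (intro exI[of _ 0]) auto
  next
    case False
    then obtain e0 where e0: "e0 \<noteq> 0" "row_integral e0" "\<forall>j. conformal (a j \<bullet> e0) (a j \<bullet> d)"
      "\<forall>f \<beta>. step_bound f \<beta> \<longrightarrow> \<bar>f \<bullet> e0\<bar> \<le> \<beta> / real k"
      by (rule ex_conformal_lattice_step[OF Suc.prems(1)])
    obtain j0 where j0: "a j0 \<bullet> e0 \<noteq> 0"
      using spanning_UNIV e0(1) by (auto simp: spanning_rows_def)
    have "\<bar>a j0 \<bullet> e0\<bar> \<ge> 1"
      using e0(2) j0 Ints_nonzero_abs_ge1 by (auto simp: row_integral_def)
    also have "\<bar>a j0 \<bullet> e0\<bar> \<le> (\<Sum>j\<in>UNIV. \<bar>a j \<bullet> e0\<bar>)"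
      by (rule member_le_sum) auto
    finally have "1 \<le> (\<Sum>j\<in>UNIV. \<bar>a j \<bullet> e0\<bar>)" .
    moreover have "(\<Sum>j\<in>UNIV. \<bar>a j \<bullet> (d - e0)\<bar>) = (\<Sum>j\<in>UNIV. \<bar>a j \<bullet> d\<bar>) - (\<Sum>j\<in>UNIV. \<bar>a j \<bullet> e0\<bar>)"
      unfolding sum_subtractf[symmetric]
      using e0(3) by (intro sum.cong refl) (simp add: inner_diff_right conformal_abs_diff)
    ultimately have less: "(\<Sum>j\<in>UNIV. \<bar>a j \<bullet> (d - e0)\<bar>) \<le> real N" using Suc.prems(2) by simp
    have "row_integral (d - e0)" using Suc.prems(1) e0(2) by (rule row_integral_diff)
    from Suc.IH[OF this less] obtain M e where e: "d - e0 = (\<Sum>t<M. e t)"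
      "\<forall>t<(M::nat). e t \<noteq> 0 \<and> row_integral (e t) \<and> (\<forall>j. conformal (a j \<bullet> e t) (a j \<bullet> (d - e0))) \<and>
        (\<forall>f \<beta>. step_bound f \<beta> \<longrightarrow> \<bar>f \<bullet> e t\<bar> \<le> \<beta> / real k)"
      by (elim exE conjE)
    have conf: "conformal (a j \<bullet> e t) (a j \<bullet> d)" if "t < M" for t j
    proof -
      have "conformal (a j \<bullet> d - a j \<bullet> e0) (a j \<bullet> d)" using e0(3) by (intro conformal_diff) blast
      moreover have "conformal (a j \<bullet> e t) (a j \<bullet> d - a j \<bullet> e0)"
        using e(2) that by (simp add: inner_diff_right)
      ultimately show ?thesis by (rule conformal_trans[rotated])
    qed
    have "d = (\<Sum>t<Suc M. (e(M := e0)) t)"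
    proof -
      have "(\<Sum>t<M. (e(M := e0)) t) = (\<Sum>t<M. e t)" by (intro sum.cong) auto
      then show ?thesis using e(1) by (simp add: algebra_simps)
    qed
    moreover have "\<forall>t<Suc M. (e(M := e0)) t \<noteq> 0 \<and> row_integral ((e(M := e0)) t) \<and>
      (\<forall>j. conformal (a j \<bullet> (e(M := e0)) t) (a j \<bullet> d)) \<and>
      (\<forall>f \<beta>. step_bound f \<beta> \<longrightarrow> \<bar>f \<bullet> (e(M := e0)) t\<bar> \<le> \<beta> / real k)"
      using e(2) e0 conf by (simp add: less_Suc_eq)
    ultimately show ?thesis by (intro exI conjI)
  qed
qed

text \<open>The lattice contains the integral vectors with index \<open>k\<close>, so among \<open>k\<close> steps of a decomposition some
  consecutive ones add up to an integral vector.\<close>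

lemma irreducible_bound:
  assumes d: "row_integral d"
    and irred: "\<And>w. integral_vec w \<Longrightarrow> \<forall>j. conformal (a j \<bullet> w) (a j \<bullet> d) \<Longrightarrow> w = 0"
    and f: "step_bound f \<beta>"
  shows "\<bar>f \<bullet> d\<bar> \<le> (real k - 1) * \<beta> / real k"
proof -
  obtain N where "(\<Sum>j\<in>UNIV. \<bar>a j \<bullet> d\<bar>) \<le> real N"
    using real_arch_simple by blast
  with d have "\<exists>M e. d = (\<Sum>t<M. e t) \<and> (\<forall>t<(M::nat). e t \<noteq> 0 \<and> row_integral (e t) \<and>
      (\<forall>j. conformal (a j \<bullet> e t) (a j \<bullet> d)) \<and>
      (\<forall>f \<beta>. step_bound f \<beta> \<longrightarrow> \<bar>f \<bullet> e t\<bar> \<le> \<beta> / real k))"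
    by (rule conformal_decomposition)
  then obtain M e where M: "d = (\<Sum>t<M. e t)"
    and e: "\<And>t. t < (M::nat) \<Longrightarrow> e t \<noteq> 0" "\<And>t. t < M \<Longrightarrow> row_integral (e t)"
      "\<And>t j. t < M \<Longrightarrow> conformal (a j \<bullet> e t) (a j \<bullet> d)"
      "\<And>t. t < M \<Longrightarrow> \<bar>f \<bullet> e t\<bar> \<le> \<beta> / real k"
    using f by blast
  have "M < k"
  proof (rule ccontr)
    assume "\<not> M < k"
    define s where "s = (\<lambda>q. \<Sum>t<q. e t)"
    obtain r where r: "\<bar>minor a r\<bar> = real k" using ex_minor_k by blast
    have srow: "row_integral (s q)" if "q \<le> k" for q
      unfolding s_def row_integral_def inner_sum_right
      using e(2) that \<open>\<not> M < k\<close> by (auto simp: row_integral_def intro!: Ints_sum)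
    define B :: "real^'n^'n" where "B = (\<chi> i. a (r i))"
    have "integral_vec (B $ i)" for i using integral_row by (simp add: B_def)
    moreover have "\<bar>det B\<bar> = real k" using r by (simp add: B_def minor_def)
    moreover have "integral_vec (B *v s t)" if "t \<le> k" for t
      using srow[OF that] by (simp add: integral_vec_def row_integral_def B_def matrix_vector_mul_component)
    ultimately obtain p q where pq: "p < q" "q \<le> k" "integral_vec (s q - s p)"
      using integral_pigeonhole[of B k s] k_pos by metis
    have "{..<q} = {..<p} \<union> {p..<q}" using pq(1) by auto
    then have w: "s q - s p = (\<Sum>t\<in>{p..<q}. e t)"
      unfolding s_def by (simp add: sum.union_disjoint ivl_disj_int)
    have sub: "{p..<q} \<subseteq> {..<M}" using pq \<open>\<not> M < k\<close> by auto
    have "conformal (a j \<bullet> (s q - s p)) (a j \<bullet> d)" for j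
      unfolding w M inner_sum_right using sub e(3)[of _ j]
      by (intro conformal_sum[where D = "a j \<bullet> d"]) auto
    then have s0: "s q - s p = 0" using irred pq(3) by blast
    \<comment> \<open>On each row the terms share a sign, so a vanishing sum makes every term
      vanish.\<close>
    have "a j \<bullet> e p = 0" for j
    proof -
      have "conformal (\<Sum>t\<in>{p}. a j \<bullet> e t) (\<Sum>t\<in>{p..<q}. a j \<bullet> e t)"
        using pq(1) sub e(3)[of _ j] by (intro conformal_sum[where D = "a j \<bullet> d"]) auto
      moreover have "(\<Sum>t\<in>{p..<q}. a j \<bullet> e t) = 0"
        using s0 unfolding w by (metis inner_sum_right inner_zero_right)
      ultimately show ?thesis by (auto simp: conformal_def)
    qed
    then have "e p = 0" using spanning_UNIV by (simp add: spanning_rows_def)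
    then show False using e(1)[of p] sub pq(1) by auto
  qed
  have "\<bar>f \<bullet> d\<bar> \<le> (\<Sum>t<M. \<bar>f \<bullet> e t\<bar>)"
    unfolding M inner_sum_right by (rule sum_abs)
  also have "\<dots> \<le> (\<Sum>t<M. \<beta> / real k)" using e(4) by (intro sum_mono) auto
  also have "\<dots> = real M * (\<beta> / real k)" by simp
  also have "\<dots> \<le> (real k - 1) * (\<beta> / real k)"
    using \<open>M < k\<close> step_bound_nonneg[OF f] by (intro mult_right_mono) auto
  finally show ?thesis by simp
qed

end

section \<open>Proximity to a vertex\<close>

context two_modular
begin

text \<open>Tight rows have integral products, so tight rows with minor k in absolute value would
  put the vertex into the lattice. This supplies the larger minor exactly when an extra half step
  has to be paid for.\<close>

lemma extreme_point_minor_2k: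
  assumes "x extreme_point_of slab a l u" "\<not> row_integral x"
  obtains r where "\<bar>minor a r\<bar> = 2 * real k"
proof -
  have "spanning_rows a (tight_rows a l u x)"
    using assms(1) by (rule extreme_point_spanning_tight_rows)
  then obtain r where r: "range r \<subseteq> tight_rows a l u x" "minor a r \<noteq> 0"
    by (rule ex_minor_nz)
  have "a (r i) \<bullet> x \<in> \<int>" for i
    using range_subsetD[OF r(1), of i] by (auto simp: tight_rows_def)
  from exchange_to_minor_k[OF r(2) this assms(2)] show thesis
    using that by blast
qed

text \<open>A vertex in the lattice serves as \<open>y\<close> itself; otherwise one half step
  toward \<open>z\<close> suffices, without leaving the slab.\<close>

lemma ex_lattice_point_toward:
  assumes x: "x extreme_point_of slab a l u" and z: "z \<in> slab a l u" "row_integral z"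
  obtains y where "y \<in> slab a l u" "row_integral y"
    "\<forall>j\<in>tight_rows a l u x. conformal (a j \<bullet> (y - x)) (a j \<bullet> (z - x))"
    "\<forall>f \<beta>. step_bound f \<beta> \<longrightarrow> \<bar>f \<bullet> (y - x)\<bar> \<le> (if row_integral x then 0 else \<beta> / (2 * real k))"
proof (cases "row_integral x")
  case True
  then show thesis
    using x by (intro that[of x]) (auto simp: extreme_point_of_def conformal_def)
next
  case False
  have xs: "x \<in> slab a l u" using x by (simp add: extreme_point_of_def)
  have T: "tight_rows a l u x \<subseteq> {j. a j \<bullet> x \<in> \<int>}" by (auto simp: tight_rows_def)
  have "spanning_rows a {j. a j \<bullet> x \<in> \<int>}"
    using extreme_point_spanning_tight_rows[OF x] T by (rule spanning_rows_mono)
  then obtain h where h: "h \<in> half_steps" "row_integral (x + h)"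
    "\<forall>j. a j \<bullet> x \<in> \<int> \<longrightarrow> conformal (a j \<bullet> h) (a j \<bullet> (z - x))"
    "\<forall>j. \<forall>m\<in>\<int>. a j \<bullet> x \<le> m \<longrightarrow> a j \<bullet> z \<le> m \<longrightarrow> a j \<bullet> (x + h) \<le> m"
    "\<forall>j. \<forall>m\<in>\<int>. a j \<bullet> x \<ge> m \<longrightarrow> a j \<bullet> z \<ge> m \<longrightarrow> a j \<bullet> (x + h) \<ge> m"
    by (rule half_step_toward[OF False _ z(2)])
  show thesis
  proof (rule that[of "x + h"])
    show "x + h \<in> slab a l u"
      using h(4,5) xs z(1) by (auto simp: slab_def)
    show "\<forall>j\<in>tight_rows a l u x. conformal (a j \<bullet> (x + h - x)) (a j \<bullet> (z - x))"
      using h(3) T by auto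
    show "\<forall>f \<beta>. step_bound f \<beta> \<longrightarrow> \<bar>f \<bullet> (x + h - x)\<bar> \<le> (if row_integral x then 0 else \<beta> / (2 * real k))"
      using half_step_bound[OF h(1)] False by simp
  qed (rule h(2))
qed

text \<open>Among the integral points that are at least as good as \<open>z0\<close>, take \<open>z\<close> closest to \<open>x\<close> as measured by the tight
  rows. An integral vector conformal to \<open>z - y\<close>, where \<open>y\<close> is the lattice point next to \<open>x\<close>, could be subtracted
  from \<open>z\<close>, so \<open>z - y\<close> is irreducible.\<close>

lemma slab_proximity:
  assumes x: "x extreme_point_of slab a l u" and c: "\<forall>y\<in>slab a l u. c \<bullet> y \<le> c \<bullet> x"
    and z0: "z0 \<in> slab a l u" "integral_vec z0"
  obtains z where "z \<in> slab a l u" "integral_vec z" "c \<bullet> z0 \<le> c \<bullet> z"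
    "\<forall>f \<beta>. step_bound f \<beta> \<longrightarrow>
      \<bar>f \<bullet> (z - x)\<bar> \<le> (if row_integral x then real k - 1 else real k - 1 / 2) * \<beta> / real k"
proof -
  define T where "T = tight_rows a l u x"
  have T: "spanning_rows a T" unfolding T_def using x by (rule extreme_point_spanning_tight_rows)
  have xs: "x \<in> slab a l u" using x by (simp add: extreme_point_of_def)
  define P where "P = (\<lambda>z. z \<in> slab a l u \<and> integral_vec z \<and> c \<bullet> z0 \<le> c \<bullet> z)"
  \<comment> \<open>Tight rows have integral right-hand sides, so this distance is an integer on
    integral vectors and a minimum exists; they span, so removing a nonzero conformal part lowers it
    strictly.\<close>
  define \<phi> where "\<phi> = (\<lambda>z. \<Sum>j\<in>T. \<bar>a j \<bullet> (z - x)\<bar>)"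
  have \<phi>_int: "\<phi> z \<in> \<int>" if "integral_vec z" for z
  proof -
    have "a j \<bullet> z - a j \<bullet> x \<in> \<int>" if "j \<in> T" for j
      using integral_imp_row_integral[OF \<open>integral_vec z\<close>] that
      by (intro Ints_diff) (auto simp: T_def tight_rows_def row_integral_def)
    then show ?thesis
      unfolding \<phi>_def by (intro Ints_sum Ints_abs) (simp add: inner_diff_right)
  qed
  have "P z0" using z0 by (simp add: P_def)
  then obtain z where z: "P z" "\<And>y. P y \<Longrightarrow> nat \<lfloor>\<phi> z\<rfloor> \<le> nat \<lfloor>\<phi> y\<rfloor>"
    using ex_has_least_nat[of P z0 "\<lambda>z. nat \<lfloor>\<phi> z\<rfloor>"] by blast
  have zs: "z \<in> slab a l u" "integral_vec z" "c \<bullet> z0 \<le> c \<bullet> z" using z(1) by (auto simp: P_def)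
  obtain y where y: "y \<in> slab a l u" "row_integral y"
    "\<forall>j\<in>tight_rows a l u x. conformal (a j \<bullet> (y - x)) (a j \<bullet> (z - x))"
    "\<forall>f \<beta>. step_bound f \<beta> \<longrightarrow> \<bar>f \<bullet> (y - x)\<bar> \<le> (if row_integral x then 0 else \<beta> / (2 * real k))"
    by (rule ex_lattice_point_toward[OF x zs(1) integral_imp_row_integral[OF zs(2)]])
  have irred: "w = 0" if w: "integral_vec w" "\<forall>j. conformal (a j \<bullet> w) (a j \<bullet> (z - y))" for w
  proof (rule ccontr)
    assume "w \<noteq> 0"
    \<comment> \<open>On tight rows \<open>y - x\<close> is a conformal part of
      \<open>z - x\<close>, so the rest \<open>z - y\<close> is conformal to \<open>z - x\<close>
      too.\<close>
    have wT: "conformal (a j \<bullet> w) (a j \<bullet> (z - x))" if "j \<in> T" for j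
    proof -
      have "conformal (a j \<bullet> (z - x) - a j \<bullet> (y - x)) (a j \<bullet> (z - x))"
        using y(3) that by (intro conformal_diff) (auto simp: T_def)
      moreover have "a j \<bullet> (z - x) - a j \<bullet> (y - x) = a j \<bullet> (z - y)"
        by (simp add: inner_diff_right)
      ultimately show ?thesis using w(2) conformal_trans by metis
    qed
    have "z - w \<in> slab a l u"
      unfolding slab_def
    proof (intro CollectI allI)
      fix j
      \<comment> \<open>Each row product of \<open>z - w\<close> lies between those of
        \<open>y\<close> and \<open>z\<close>.\<close>
      have "conformal (a j \<bullet> w) (a j \<bullet> z - a j \<bullet> y)" using w(2) by (simp add: inner_diff_right)
      moreover have "of_int (l j) \<le> a j \<bullet> z" "a j \<bullet> z \<le> of_int (u j)"
        "of_int (l j) \<le> a j \<bullet> y" "a j \<bullet> y \<le> of_int (u j)"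
        using zs(1) y(1) by (auto simp: slab_def)
      ultimately show "of_int (l j) \<le> a j \<bullet> (z - w) \<and> a j \<bullet> (z - w) \<le> of_int (u j)"
        by (auto simp: conformal_def inner_diff_right)
    qed
    moreover have "integral_vec (z - w)" using zs(2) w(1) by (rule integral_vec_diff)
    \<comment> \<open>On tight rows \<open>w\<close> has the signs of \<open>z - x\<close>, so it
      points from \<open>x\<close> into the slab; optimality of \<open>x\<close> gives
      \<open>c \<bullet> w \<le> 0\<close>, and subtracting \<open>w\<close> loses nothing.\<close>
    moreover have "c \<bullet> z0 \<le> c \<bullet> (z - w)"
    proof -
      have zl: "of_int (l j) \<le> a j \<bullet> z" "a j \<bullet> z \<le> of_int (u j)" for j
        using zs(1) by (auto simp: slab_def)
      have "a j \<bullet> w \<ge> 0" if "a j \<bullet> x = of_int (l j)" for j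
        using wT[of j] zl(1)[of j] that by (auto simp: conformal_def T_def tight_rows_def inner_diff_right)
      moreover have "a j \<bullet> w \<le> 0" if "a j \<bullet> x = of_int (u j)" for j
        using wT[of j] zl(2)[of j] that by (auto simp: conformal_def T_def tight_rows_def inner_diff_right)
      ultimately obtain \<epsilon> where "\<epsilon> > 0" "x + \<epsilon> *\<^sub>R w \<in> slab a l u"
        by (rule slab_feasible_direction[OF xs])
      then have "\<epsilon> * (c \<bullet> w) \<le> 0" using c by (fastforce simp: inner_add_right)
      then have "c \<bullet> w \<le> 0" using \<open>\<epsilon> > 0\<close> by (simp add: mult_le_0_iff)
      then show ?thesis using zs(3) by (simp add: inner_diff_right)
    qed
    ultimately have Pw: "P (z - w)" by (simp add: P_def)
    obtain j0 where j0: "j0 \<in> T" "a j0 \<bullet> w \<noteq> 0"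
      using T \<open>w \<noteq> 0\<close> by (auto simp: spanning_rows_def)
    have "\<phi> (z - w) = \<phi> z - (\<Sum>j\<in>T. \<bar>a j \<bullet> w\<bar>)"
      unfolding \<phi>_def sum_subtractf[symmetric]
    proof (intro sum.cong refl)
      fix j assume "j \<in> T"
      have "a j \<bullet> (z - w - x) = a j \<bullet> (z - x) - a j \<bullet> w" by (simp add: inner_diff_right)
      then show "\<bar>a j \<bullet> (z - w - x)\<bar> = \<bar>a j \<bullet> (z - x)\<bar> - \<bar>a j \<bullet> w\<bar>"
        using conformal_abs_diff[OF wT[OF \<open>j \<in> T\<close>]] by simp
    qed
    moreover have "\<bar>a j0 \<bullet> w\<bar> \<le> (\<Sum>j\<in>T. \<bar>a j \<bullet> w\<bar>)"
      using j0(1) by (intro member_le_sum[of j0 T "\<lambda>j. \<bar>a j \<bullet> w\<bar>"]) auto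
    ultimately have "\<phi> (z - w) < \<phi> z" using j0(2) by simp
    moreover have "\<phi> (z - w) \<ge> 0" unfolding \<phi>_def by (intro sum_nonneg) auto
    moreover obtain m m' where "\<phi> (z - w) = of_int m" "\<phi> z = of_int m'"
      using \<phi>_int zs(2) \<open>integral_vec (z - w)\<close> by (meson Ints_cases)
    ultimately have "nat \<lfloor>\<phi> (z - w)\<rfloor> < nat \<lfloor>\<phi> z\<rfloor>" by auto
    then show False using z(2)[OF Pw] by linarith
  qed
  have zy: "row_integral (z - y)"
    using integral_imp_row_integral[OF zs(2)] y(2) by (rule row_integral_diff)
  show thesis
  proof (rule that[OF zs], intro allI impI)
    fix f \<beta> assume b: "step_bound f \<beta>"
    have "\<bar>f \<bullet> (z - y)\<bar> \<le> (real k - 1) * \<beta> / real k"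
      using zy irred b by (rule irreducible_bound)
    moreover have "\<bar>f \<bullet> (y - x)\<bar> \<le> (if row_integral x then 0 else \<beta> / (2 * real k))"
      using y(4) b by blast
    moreover have "f \<bullet> (z - x) = f \<bullet> (z - y) + f \<bullet> (y - x)" by (simp add: inner_diff_right)
    moreover have "(real k - 1 / 2) * \<beta> / real k = (real k - 1) * \<beta> / real k + \<beta> / (2 * real k)"
      using k_pos by (simp add: field_simps)
    ultimately show "\<bar>f \<bullet> (z - x)\<bar> \<le> (if row_integral x then real k - 1 else real k - 1 / 2) * \<beta> / real k"
      by (auto split: if_splits)
  qed
qed

end

section \<open>Submatrix determinants\<close>

text \<open>Permutations of \<open>{..<n}\<close> are transported to the index type along
  \<open>e\<close>, which preserves signs.\<close>

lemma sum_permutes_eq_det: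
  fixes M :: "real^'n^'n" and n :: nat
  assumes e: "bij_betw e {..<n} (UNIV :: 'n set)"
  shows "(\<Sum>p | p permutes {..<n}. of_int (sign p) * (\<Prod>i<n. M $ e i $ e (p i))) = det M"
proof -
  let ?N = "{..<n}" and ?m = "map_permutation {..<n} e"
  define e' where "e' = inv_into ?N e"
  have e': "bij_betw e' UNIV ?N" unfolding e'_def using e by (rule bij_betw_inv_into)
  have e'e: "e' (e i) = i" if "i \<in> ?N" for i
    unfolding e'_def using e that by (simp add: bij_betw_inv_into_left)
  have ee': "e (e' i) = i" for i
    unfolding e'_def using e by (simp add: bij_betw_inv_into_right)
  have bij: "bij_betw ?m {p. p permutes ?N} {p. p permutes (UNIV :: 'n set)}"
  proof (rule bij_betw_byWitness[where f' = "map_permutation UNIV e'"])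
    show "\<forall>p\<in>{p. p permutes ?N}. map_permutation UNIV e' (?m p) = p"
      using map_permutation_compose_inv[OF e] e'e by blast
    show "\<forall>p\<in>{p. p permutes UNIV}. ?m (map_permutation UNIV e' p) = p"
      using map_permutation_compose_inv[OF e'] ee' by blast
    show "?m ` {p. p permutes ?N} \<subseteq> {p. p permutes UNIV}"
      using map_permutation_permutes[OF e] by blast
    show "map_permutation UNIV e' ` {p. p permutes UNIV} \<subseteq> {p. p permutes ?N}"
      using map_permutation_permutes[OF e'] by blast
  qed
  have inj: "inj_on e ?N" using e by (simp add: bij_betw_def)
  have "det M = (\<Sum>p | p permutes ?N. of_int (sign (?m p)) * (\<Prod>i\<in>UNIV. M $ i $ ?m p i))"
    unfolding det_def by (rule sum.reindex_bij_betw[OF bij, symmetric])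
  also have "\<dots> = (\<Sum>p | p permutes ?N. of_int (sign p) * (\<Prod>i<n. M $ e i $ e (p i)))"
  proof (intro sum.cong refl)
    fix p assume p: "p \<in> {p. p permutes ?N}"
    have "(\<Prod>i\<in>UNIV. M $ i $ ?m p i) = (\<Prod>i<n. M $ e i $ ?m p (e i))"
      by (rule prod.reindex_bij_betw[OF e, symmetric])
    also have "\<dots> = (\<Prod>i<n. M $ e i $ e (p i))"
      using inj by (intro prod.cong refl) (simp add: map_permutation_apply)
    finally show "of_int (sign (?m p)) * (\<Prod>i\<in>UNIV. M $ i $ ?m p i) =
        of_int (sign p) * (\<Prod>i<n. M $ e i $ e (p i))"
      using p inj by (subst sign_map_permutation) auto
  qed
  finally show ?thesis by simp
qed

lemma abs_sum_permutes_eq_abs_det: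
  fixes M :: "real^'n^'n" and n :: nat
  assumes e: "bij_betw e {..<n} (UNIV :: 'n set)" and g: "bij_betw g {..<n} (UNIV :: 'n set)"
  shows "\<bar>\<Sum>p | p permutes {..<n}. of_int (sign p) * (\<Prod>i<n. M $ e i $ g (p i))\<bar> = \<bar>det M\<bar>"
proof -
  define \<tau> where "\<tau> = g \<circ> inv_into {..<n} e"
  have "bij_betw \<tau> UNIV UNIV"
    unfolding \<tau>_def using bij_betw_inv_into[OF e] g by (rule bij_betw_trans)
  then have \<tau>: "\<tau> permutes UNIV" by (auto intro: bij_imp_permutes)
  have \<tau>e: "\<tau> (e i) = g i" if "i < n" for i
    unfolding \<tau>_def using e that by (simp add: bij_betw_inv_into_left)
  define M' :: "real^'n^'n" where "M' = (\<chi> i j. M $ i $ \<tau> j)"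
  have "(\<Sum>p | p permutes {..<n}. of_int (sign p) * (\<Prod>i<n. M $ e i $ g (p i))) =
      (\<Sum>p | p permutes {..<n}. of_int (sign p) * (\<Prod>i<n. M' $ e i $ e (p i)))"
  proof (intro sum.cong refl arg_cong2[of _ _ _ _ "(*)"] prod.cong)
    fix p i assume "p \<in> {p. p permutes {..<n}}" "i \<in> {..<n}"
    then have "p i < n" using permutes_in_image[of p "{..<n}" i] by simp
    then show "M $ e i $ g (p i) = M' $ e i $ e (p i)" by (simp add: M'_def \<tau>e)
  qed
  also have "\<dots> = det M'" by (rule sum_permutes_eq_det[OF e])
  also have "\<dots> = of_int (sign \<tau>) * det M" unfolding M'_def by (rule det_permute_columns[OF \<tau>])
  finally show ?thesis by (simp add: abs_mult sign_def)
qed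

text \<open>With \<open>p\<close> listed last, dropping the last index deletes exactly this row or
  column.\<close>

lemma ex_bij_betw_last:
  fixes p :: "'n::finite"
  obtains e where "bij_betw e {..<CARD('n)} (UNIV :: 'n set)" "e (CARD('n) - 1) = p"
proof -
  obtain e0 where e0: "bij_betw e0 {..<CARD('n)} (UNIV :: 'n set)"
    using finite_same_card_bij[of "{..<CARD('n)}" "UNIV :: 'n set"] by auto
  define t where "t = Transposition.transpose (e0 (CARD('n) - 1)) p"
  have "bij_betw t UNIV UNIV" unfolding t_def by simp
  then have "bij_betw (t \<circ> e0) {..<CARD('n)} UNIV" using e0 bij_betw_trans by blast
  moreover have "(t \<circ> e0) (CARD('n) - 1) = p" by (simp add: t_def)
  ultimately show thesis by (rule that)
qed

lemma sub_det_eq_minor: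
  fixes A :: "int^'n^'m"
  assumes e: "bij_betw e {..<CARD('n)} (UNIV :: 'n set)"
  shows "real_of_int (sub_det A (CARD('n)) (r \<circ> e) e) = minor (row_real A) r"
proof -
  have "real_of_int (sub_det A (CARD('n)) (r \<circ> e) e) =
      (\<Sum>p | p permutes {..<CARD('n)}. of_int (sign p) * (\<Prod>i<CARD('n). (\<chi> i. row_real A (r i)) $ e i $ e (p i)))"
    by (simp add: sub_det_def row_real_def)
  also have "\<dots> = minor (row_real A) r"
    unfolding minor_def by (rule sum_permutes_eq_det[OF e])
  finally show ?thesis .
qed

text \<open>Row \<open>p\<close> of the matrix is a unit vector, so in the Leibniz sum only
  permutations fixing the last index survive, and these are the permutations of the smaller index
  set.\<close>

lemma abs_sub_det_eq_abs_cofactor_vec: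
  fixes A :: "int^'n^'m"
  assumes e: "bij_betw e {..<CARD('n)} (UNIV :: 'n set)" "e (CARD('n) - 1) = p"
    and g: "bij_betw g {..<CARD('n)} (UNIV :: 'n set)" "g (CARD('n) - 1) = j"
  shows "real_of_int \<bar>sub_det A (CARD('n) - 1) (r \<circ> e) g\<bar> = \<bar>cofactor_vec (row_real A) r p $ j\<bar>"
proof -
  define n where "n = CARD('n) - 1"
  have n: "CARD('n) = Suc n" by (simp add: n_def)
  define M :: "real^'n^'n" where "M = (\<chi> i. if i = p then axis j 1 else row_real A (r i))"
  let ?f = "\<lambda>N q. of_int (sign q) * (\<Prod>i<N. M $ e i $ g (q i))"
  have en: "e n = p" and gn: "g n = j" using e(2) g(2) by (simp_all only: n_def)
  have inje: "e i \<noteq> p" if "i < n" for i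
    using e(1) that en inj_onD[of e "{..<CARD('n)}" i n] by (auto simp: bij_betw_def n)
  have "(\<Sum>q | q permutes {..<n}. ?f (Suc n) q) = (\<Sum>q | q permutes {..<Suc n}. ?f (Suc n) q)"
  proof (rule sum.mono_neutral_left)
    show "finite {q. q permutes {..<Suc n}}" by (simp add: finite_permutations)
    show "{q. q permutes {..<n}} \<subseteq> {q. q permutes {..<Suc n}}"
      by (auto intro: permutes_subset)
    show "\<forall>q\<in>{q. q permutes {..<Suc n}} - {q. q permutes {..<n}}. ?f (Suc n) q = 0"
    proof
      fix q assume "q \<in> {q. q permutes {..<Suc n}} - {q. q permutes {..<n}}"
      then have q: "q permutes {..<Suc n}" "\<not> q permutes {..<n}" by auto
      have "q n \<noteq> n"
      proof
        assume "q n = n"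
        then have "q permutes {..<n}"
          using q(1) by (intro permutes_superset[OF q(1)]) auto
        then show False using q(2) by simp
      qed
      moreover have "q n < Suc n" using q(1) permutes_in_image[of q "{..<Suc n}" n] by simp
      ultimately have "g (q n) \<noteq> j"
        using g(1) gn inj_onD[of g "{..<CARD('n)}" "q n" n] by (auto simp: bij_betw_def n)
      then have "M $ e n $ g (q n) = 0" by (simp add: M_def en axis_def)
      then show "?f (Suc n) q = 0" by simp
    qed
  qed
  moreover have "?f (Suc n) q = of_int (sign q) * (\<Prod>i<n. row_real A (r (e i)) $ g (q i))"
    if "q permutes {..<n}" for q
  proof -
    have "q n = n" using that by (simp add: permutes_def)
    then have "M $ e n $ g (q n) = 1" by (simp add: M_def en gn)
    moreover have "(\<Prod>i<n. M $ e i $ g (q i)) = (\<Prod>i<n. row_real A (r (e i)) $ g (q i))"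
      using inje by (intro prod.cong refl) (simp add: M_def)
    ultimately show ?thesis by simp
  qed
  moreover have "real_of_int (sub_det A n (r \<circ> e) g) =
      (\<Sum>q | q permutes {..<n}. of_int (sign q) * (\<Prod>i<n. row_real A (r (e i)) $ g (q i)))"
    by (simp add: sub_det_def row_real_def)
  moreover have "\<bar>\<Sum>q | q permutes {..<Suc n}. ?f (Suc n) q\<bar> = \<bar>det M\<bar>"
    using abs_sum_permutes_eq_abs_det[OF e(1) g(1), of M] by (simp only: n)
  ultimately have "\<bar>real_of_int (sub_det A n (r \<circ> e) g)\<bar> = \<bar>det M\<bar>" by simp
  then show ?thesis by (simp add: n_def cofactor_vec_def M_def)
qed

text \<open>The work is finiteness of the set under \<open>Max\<close>: selections are functions on
  all natural numbers, but the determinant depends only on their restrictions to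
  \<open>{..<j}\<close>.\<close>

lemma Delta_ge:
  fixes A :: "int^'n^'m"
  assumes "inj_on f {..<j}" "inj_on g {..<j}"
  shows "\<bar>sub_det A j f g\<bar> \<le> Delta j A"
proof -
  let ?S = "{\<bar>sub_det A j f g\<bar> | f g. inj_on f {..<j} \<and> inj_on g {..<j}}"
  let ?D = "Pi\<^sub>E {..<j} (\<lambda>_. UNIV :: 'm set) \<times> Pi\<^sub>E {..<j} (\<lambda>_. UNIV :: 'n set)"
  have eq: "sub_det A j f g = sub_det A j (restrict f {..<j}) (restrict g {..<j})" for f g
    unfolding sub_det_def
  proof (intro sum.cong refl arg_cong2[of _ _ _ _ "(*)"] prod.cong)
    fix p i assume "p \<in> {p. p permutes {..<j}}" "i \<in> {..<j}"
    then have "p i < j" "i < j" using permutes_in_image[of p "{..<j}" i] by auto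
    then show "A $ f i $ g (p i) = A $ restrict f {..<j} i $ restrict g {..<j} (p i)" by simp
  qed
  have "?S \<subseteq> (\<lambda>(f, g). \<bar>sub_det A j f g\<bar>) ` ?D"
  proof
    fix x assume "x \<in> ?S"
    then obtain f g where "x = \<bar>sub_det A j f g\<bar>" by auto
    then have "x = \<bar>sub_det A j (restrict f {..<j}) (restrict g {..<j})\<bar>" using eq by metis
    then show "x \<in> (\<lambda>(f, g). \<bar>sub_det A j f g\<bar>) ` ?D"
      by (intro image_eqI[of _ _ "(restrict f {..<j}, restrict g {..<j})"]) auto
  qed
  moreover have "finite ?D" by (intro finite_cartesian_product finite_PiE) auto
  ultimately have "finite ?S" by (meson finite_imageI finite_subset)
  then show ?thesis
    unfolding Delta_def using assms by (intro Max_ge) auto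
qed

lemma minor_le_Delta:
  fixes A :: "int^'n^'m"
  assumes "minor (row_real A) r \<noteq> 0"
  shows "\<bar>minor (row_real A) r\<bar> \<le> real_of_int (Delta (CARD('n)) A)"
proof -
  obtain e where e: "bij_betw e {..<CARD('n)} (UNIV :: 'n set)"
    using ex_bij_betw_last by blast
  have "inj r" using assms minor_eq_0_if_not_inj by blast
  then have "inj_on (r \<circ> e) {..<CARD('n)}" "inj_on e {..<CARD('n)}"
    using e by (auto simp: bij_betw_def intro: comp_inj_on inj_on_subset)
  then have "\<bar>sub_det A (CARD('n)) (r \<circ> e) e\<bar> \<le> Delta (CARD('n)) A" by (rule Delta_ge)
  then show ?thesis
    by (simp flip: sub_det_eq_minor[OF e])
qed

text \<open>A row repeated outside position \<open>p\<close> would make all coordinates vanish, so a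
  nonzero vector comes from an injective selection, as \<open>Delta\<close> requires.\<close>

lemma cofactor_vec_le_Delta:
  fixes A :: "int^'n^'m"
  assumes "cofactor_vec (row_real A) r p \<noteq> 0"
  shows "\<bar>cofactor_vec (row_real A) r p $ j\<bar> \<le> real_of_int (Delta (CARD('n) - 1) A)"
proof -
  obtain e where e: "bij_betw e {..<CARD('n)} (UNIV :: 'n set)" "e (CARD('n) - 1) = p"
    by (rule ex_bij_betw_last)
  obtain g where g: "bij_betw g {..<CARD('n)} (UNIV :: 'n set)" "g (CARD('n) - 1) = j"
    by (rule ex_bij_betw_last)
  have inj: "inj_on r (UNIV - {p})"
  proof (rule ccontr)
    assume "\<not> inj_on r (UNIV - {p})"
    then obtain i i' where "i \<noteq> i'" "i \<noteq> p" "i' \<noteq> p" "r i = r i'" by (auto simp: inj_on_def)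
    then have "cofactor_vec (row_real A) r p $ l = 0" for l
      unfolding cofactor_vec_def vec_lambda_beta
      by (intro det_identical_rows[of i i']) (auto simp: row_def vec_eq_iff)
    then show False using assms by (simp add: vec_eq_iff)
  qed
  have "e ` {..<CARD('n) - 1} \<subseteq> UNIV - {p}"
    using e inj_onD[of e "{..<CARD('n)}" _ "CARD('n) - 1"] by (fastforce simp: bij_betw_def)
  moreover have "inj_on e {..<CARD('n) - 1}"
    using e(1) by (auto simp: bij_betw_def intro: inj_on_subset)
  ultimately have "inj_on (r \<circ> e) {..<CARD('n) - 1}"
    using inj by (intro comp_inj_on) (auto intro: inj_on_subset)
  moreover have "inj_on g {..<CARD('n) - 1}"
    using g(1) by (auto simp: bij_betw_def intro: inj_on_subset)
  ultimately have "\<bar>sub_det A (CARD('n) - 1) (r \<circ> e) g\<bar> \<le> Delta (CARD('n) - 1) A" by (rule Delta_ge)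
  then show ?thesis
    using abs_sub_det_eq_abs_cofactor_vec[OF e g, of A r] by linarith
qed

section \<open>Proximity and flatness\<close>

text \<open>Cramer's rule on one nonsingular choice of rows bounds every coordinate.\<close>

lemma compact_slab:
  fixes a :: "'m::finite \<Rightarrow> real^'n"
  assumes "spanning_rows a UNIV"
  shows "compact (slab a l u)"
proof -
  obtain r where r: "minor a r \<noteq> 0" using assms by (rule ex_minor_nz)
  define C where "C = (\<lambda>i. (\<Sum>p\<in>UNIV. \<bar>cofactor_vec a r p $ i\<bar> * (\<bar>real_of_int (l (r p))\<bar> + \<bar>real_of_int (u (r p))\<bar>)) / \<bar>minor a r\<bar>)"
  have "\<bar>y $ i\<bar> \<le> C i" if y: "y \<in> slab a l u" for y i
  proof -
    have "minor a r * y $ i = (\<Sum>p\<in>UNIV. cofactor_vec a r p $ i * (a (r p) \<bullet> y))"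
      using cramer_rows[OF r, of "axis i 1" y] by (simp add: inner_axis inner_axis')
    then have "\<bar>minor a r\<bar> * \<bar>y $ i\<bar> \<le> (\<Sum>p\<in>UNIV. \<bar>cofactor_vec a r p $ i * (a (r p) \<bullet> y)\<bar>)"
      by (metis abs_mult sum_abs)
    also have "\<dots> \<le> (\<Sum>p\<in>UNIV. \<bar>cofactor_vec a r p $ i\<bar> * (\<bar>real_of_int (l (r p))\<bar> + \<bar>real_of_int (u (r p))\<bar>))"
    proof (intro sum_mono)
      fix p
      have "real_of_int (l (r p)) \<le> a (r p) \<bullet> y" "a (r p) \<bullet> y \<le> real_of_int (u (r p))"
        using y by (auto simp: slab_def)
      then have "\<bar>a (r p) \<bullet> y\<bar> \<le> \<bar>real_of_int (l (r p))\<bar> + \<bar>real_of_int (u (r p))\<bar>" by linarith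
      then show "\<bar>cofactor_vec a r p $ i * (a (r p) \<bullet> y)\<bar> \<le>
          \<bar>cofactor_vec a r p $ i\<bar> * (\<bar>real_of_int (l (r p))\<bar> + \<bar>real_of_int (u (r p))\<bar>)"
        by (simp add: abs_mult mult_left_mono)
    qed
    finally show ?thesis
      using r by (simp add: C_def field_simps)
  qed
  then have "norm y \<le> (\<Sum>i\<in>UNIV. C i)" if "y \<in> slab a l u" for y
    using that norm_le_l1_cart[of y] by (meson order_trans sum_mono)
  then have "bounded (slab a l u)" by (auto simp: bounded_iff)
  moreover have "closed (slab a l u)"
  proof -
    have "slab a l u = (\<Inter>j. {y. a j \<bullet> y \<ge> of_int (l j)} \<inter> {y. a j \<bullet> y \<le> of_int (u j)})"
      by (auto simp: slab_def)
    then show ?thesis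
      by (simp add: closed_INT closed_Int closed_halfspace_ge closed_halfspace_le)
  qed
  ultimately show ?thesis by (simp add: compact_eq_bounded_closed)
qed

text \<open>The minimisers form a compact face, and an extreme point of a face is extreme in the
  whole set.\<close>

lemma ex_extreme_minimizer:
  fixes S :: "(real^'n) set"
  assumes "compact S" "convex S" "S \<noteq> {}"
  obtains x where "x extreme_point_of S" "\<forall>y\<in>S. c \<bullet> x \<le> c \<bullet> y"
proof -
  obtain x0 where x0: "x0 \<in> S" "\<forall>y\<in>S. c \<bullet> x0 \<le> c \<bullet> y"
    using continuous_attains_inf[OF assms(1,3), of "\<lambda>y. c \<bullet> y"] continuous_on_inner[OF continuous_on_const continuous_on_id]
    by blast
  define F where "F = S \<inter> {y. c \<bullet> y = c \<bullet> x0}"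
  have face: "F face_of S"
    unfolding F_def using x0(2) assms(2) by (intro face_of_Int_supporting_hyperplane_ge) auto
  have "compact F" unfolding F_def using assms(1) by (intro compact_Int_closed closed_hyperplane)
  moreover have "convex F" using face by (rule face_of_imp_convex)
  moreover have "F \<noteq> {}" using x0(1) by (auto simp: F_def)
  ultimately obtain x where x: "x extreme_point_of F" by (rule extreme_point_exists_convex)
  then have "x extreme_point_of S" "x \<in> F" using extreme_point_of_face[OF face] by auto
  then show thesis using that x0(2) by (auto simp: F_def)
qed

lemma ex_common_denominator:
  fixes c :: "real^'n"
  assumes "\<forall>i. c $ i \<in> \<rat>"
  obtains N :: nat where "N > 0" "integral_vec (real N *\<^sub>R c)"
proof -
  have "\<exists>d::nat. d > 0 \<and> real d * c $ i \<in> \<int>" for i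
  proof -
    obtain p q :: int where "q > 0" "c $ i = of_int p / of_int q"
      using assms by (meson Rats_cases')
    then show ?thesis by (intro exI[of _ "nat q"]) auto
  qed
  then obtain d where d: "\<And>i. d i > (0::nat)" "\<And>i. real (d i) * c $ i \<in> \<int>" by metis
  show thesis
  proof (rule that[of "\<Prod>i\<in>UNIV. d i"])
    show "(\<Prod>i\<in>UNIV. d i) > 0" using d(1) by (simp add: prod_pos)
    have "real (\<Prod>i\<in>UNIV. d i) * c $ i \<in> \<int>" for i
    proof -
      have "real (\<Prod>i\<in>UNIV. d i) * c $ i = real (\<Prod>j\<in>UNIV - {i}. d j) * (real (d i) * c $ i)"
        by (subst prod.remove[of UNIV i]) auto
      then show ?thesis using Ints_mult[OF Ints_of_nat d(2)[of i]] by (simp only:)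
    qed
    then show "integral_vec (real (\<Prod>i\<in>UNIV. d i) *\<^sub>R c)" by (simp add: integral_vec_def)
  qed
qed

text \<open>With a common denominator \<open>N\<close> of \<open>c\<close>, the objective values on
  integral points are multiples of 1/N; being bounded above, they attain a maximum.\<close>

lemma ex_integral_maximizer:
  fixes c :: "real^'n"
  assumes "\<forall>i. c $ i \<in> \<rat>" "\<forall>y\<in>S. c \<bullet> y \<le> B" "z0 \<in> S" "integral_vec z0"
  obtains z where "z \<in> S" "integral_vec z" "\<forall>y\<in>S. integral_vec y \<longrightarrow> c \<bullet> y \<le> c \<bullet> z"
proof -
  obtain N :: nat where N: "N > 0" "integral_vec (real N *\<^sub>R c)"
    using assms(1) by (rule ex_common_denominator)
  define P where "P = (\<lambda>z. z \<in> S \<and> integral_vec z)"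
  define \<phi> where "\<phi> = (\<lambda>z. nat (\<lfloor>real N * B\<rfloor> - \<lfloor>real N * (c \<bullet> z)\<rfloor>))"
  obtain z where z: "P z" "\<And>y. P y \<Longrightarrow> \<phi> z \<le> \<phi> y"
    using ex_has_least_nat[of P z0 \<phi>] assms(3,4) by (auto simp: P_def)
  have "c \<bullet> y \<le> c \<bullet> z" if "P y" for y
  proof -
    have Ncy: "\<lfloor>real N * (c \<bullet> v)\<rfloor> = real N * (c \<bullet> v)" if "P v" for v
    proof -
      have "(real N *\<^sub>R c) \<bullet> v \<in> \<int>" using N(2) that by (intro integral_vec_inner) (auto simp: P_def)
      then show ?thesis by (auto elim: Ints_cases)
    qed
    have "\<lfloor>real N * (c \<bullet> y)\<rfloor> \<le> \<lfloor>real N * B\<rfloor>"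
      using assms(2) that by (intro floor_mono mult_left_mono) (auto simp: P_def)
    then have "\<lfloor>real N * (c \<bullet> y)\<rfloor> \<le> \<lfloor>real N * (c \<bullet> z)\<rfloor>"
      using z(2)[OF that] unfolding \<phi>_def by linarith
    then have "real N * (c \<bullet> y) \<le> real N * (c \<bullet> z)"
      using Ncy[OF that] Ncy[OF z(1)] by linarith
    then show ?thesis using N(1) by simp
  qed
  then show thesis using that z(1) by (auto simp: P_def)
qed

text \<open>On a path of unit increments from \<open>b\<close> to \<open>B\<close> the predicate
  must switch to true at some step; the induction is on the length of the path.\<close>

lemma first_feasible_increment:
  fixes F :: "('m::finite \<Rightarrow> int) \<Rightarrow> bool"
  assumes "F B"
  shows "\<not> F b \<Longrightarrow> \<forall>j. b j \<le> B j \<Longrightarrow> (\<Sum>j\<in>UNIV. nat (B j - b j)) = N \<Longrightarrow>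
    \<exists>b' i. (\<forall>j. b j \<le> b' j) \<and> \<not> F b' \<and> F (b'(i := b' i + 1))"
proof (induction N arbitrary: b)
  case 0
  then have "b = B" by (auto simp: fun_eq_iff intro: order_antisym)
  then show ?case using 0 assms by simp
next
  case (Suc N)
  then obtain i where i: "b i < B i"
    by (metis (mono_tags, lifting) diff_ge_0_iff_ge nat_0_iff nat.distinct(1) not_less sum.neutral diff_le_0_iff_le)
  show ?case
  proof (cases "F (b(i := b i + 1))")
    case True
    then show ?thesis using Suc.prems(1) by blast
  next
    case False
    have "(\<Sum>j\<in>UNIV. nat (B j - b j)) = nat (B i - b i) + (\<Sum>j\<in>UNIV - {i}. nat (B j - b j))"
      by (rule sum.remove) auto
    moreover have "(\<Sum>j\<in>UNIV. nat (B j - (b(i := b i + 1)) j)) =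
        nat (B i - (b i + 1)) + (\<Sum>j\<in>UNIV - {i}. nat (B j - b j))"
      by (subst sum.remove[of UNIV i]) auto
    ultimately have "(\<Sum>j\<in>UNIV. nat (B j - (b(i := b i + 1)) j)) = N"
      using Suc.prems(3) i by linarith
    moreover have "\<forall>j. (b(i := b i + 1)) j \<le> B j" using Suc.prems(2) i by auto
    ultimately obtain b' i' where b': "\<forall>j. (b(i := b i + 1)) j \<le> b' j" "\<not> F b'" "F (b'(i' := b' i' + 1))"
      using Suc.IH[OF False] by blast
    have "b j \<le> b' j" for j using spec[OF b'(1), of j] by (cases "j = i") auto
    then show ?thesis using b'(2,3) by blast
  qed
qed

context two_modular
begin

lemma minor_le_k_if_no_2k:
  assumes "\<nexists>r. \<bar>minor a r\<bar> = 2 * real k"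
  shows "\<bar>minor a r\<bar> \<le> real k"
proof -
  have "\<bar>minor a r\<bar> \<noteq> 2 * real k" using assms by blast
  then show ?thesis using minor_cases[of r] by auto
qed

text \<open>Minimising a row is maximising \<open>- a i\<close>, and rows turn cofactor vectors into
  maximal minors. If 2k occurs, the displacement is at most (k - 1/2) times 2, that is 2k - 1;
  otherwise the vertex is in the lattice and the bound is k - 1.\<close>

lemma slab_proximity_row:
  assumes x: "x extreme_point_of slab a l u" and opt: "\<forall>y\<in>slab a l u. a i \<bullet> x \<le> a i \<bullet> y"
    and z0: "z0 \<in> slab a l u" "integral_vec z0" and \<Delta>: "\<And>r. \<bar>minor a r\<bar> \<le> \<Delta>"
  obtains z where "z \<in> slab a l u" "integral_vec z" "a i \<bullet> z \<le> a i \<bullet> x + (\<Delta> - 1)"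
proof -
  obtain z where z: "z \<in> slab a l u" "integral_vec z" "(- a i) \<bullet> z0 \<le> (- a i) \<bullet> z"
    "\<forall>f \<beta>. step_bound f \<beta> \<longrightarrow>
      \<bar>f \<bullet> (z - x)\<bar> \<le> (if row_integral x then real k - 1 else real k - 1 / 2) * \<beta> / real k"
    by (rule slab_proximity[OF x _ z0, of "- a i"]) (use opt in auto)
  have "\<bar>a i \<bullet> (z - x)\<bar> \<le> \<Delta> - 1"
  proof (cases "\<exists>r. \<bar>minor a r\<bar> = 2 * real k")
    case True
    then have \<Delta>2: "2 * real k \<le> \<Delta>" using \<Delta> by metis
    have "step_bound (a i) (2 * real k)"
      unfolding step_bound_def using minor_cases by (auto simp: row_inner_cofactor_vec)
        (smt (verit) of_nat_0_le_iff insertE singletonD)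
    then have "\<bar>a i \<bullet> (z - x)\<bar> \<le> (if row_integral x then real k - 1 else real k - 1 / 2) * (2 * real k) / real k"
      using z(4) by blast
    also have "\<dots> \<le> 2 * real k - 1" using k_pos by simp
    finally show ?thesis using \<Delta>2 by simp
  next
    case False
    then have x: "row_integral x" using extreme_point_minor_2k[OF x] by metis
    have "real k \<le> \<Delta>" using ex_minor_k \<Delta> by metis
    moreover have "step_bound (a i) (real k)"
      unfolding step_bound_def using minor_le_k_if_no_2k[OF False] by (simp add: row_inner_cofactor_vec)
    then have "\<bar>a i \<bullet> (z - x)\<bar> \<le> (real k - 1) * real k / real k"
      using z(4) x by presburger
    ultimately show ?thesis using k_pos by simp
  qed
  then show thesis using that z(1,2) by (simp add: inner_diff_right abs_le_iff)
qed

end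

section \<open>The integer matrix of the theorem\<close>

lemma spanning_rows_row_real:
  fixes A :: "int^'n^'m"
  assumes "rank (real_mat A) = CARD('n)"
  shows "spanning_rows (row_real A) UNIV"
  unfolding spanning_rows_def
proof (intro allI impI)
  fix x assume x: "\<forall>j\<in>UNIV. row_real A j \<bullet> x = 0"
  have "(real_mat A *v x) $ j = 0" for j
  proof -
    have "real_mat A $ j = row_real A j" by (simp add: real_mat_def row_real_def)
    then show ?thesis using x by (simp only: matrix_vector_mul_component) simp
  qed
  then have "real_mat A *v x = real_mat A *v 0"
    by (simp add: vec_eq_iff)
  moreover have "inj ((*v) (real_mat A))" using assms by (simp add: full_rank_injective)
  ultimately show "x = 0" by (rule injD[rotated])
qed

lemma two_modular_row_real:
  fixes A :: "int^'n^'m" and k :: int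
  assumes fullrank: "rank (real_mat A) = CARD('n)" and k1: "k \<ge> 1"
    and minors: "\<And>f g. inj_on f {..<CARD('n)} \<Longrightarrow> inj_on g {..<CARD('n)} \<Longrightarrow>
                   sub_det A (CARD('n)) f g \<in> {0, k, -k, 2*k, -2*k}"
  obtains K where "two_modular (row_real A) K"
proof -
  let ?a = "row_real A"
  have span: "spanning_rows ?a UNIV" using fullrank by (rule spanning_rows_row_real)
  have cases: "minor ?a r \<in> {0, of_int k, - of_int k, 2 * of_int k, - (2 * of_int k)}" for r
  proof (cases "inj r")
    case False
    then show ?thesis by (simp add: minor_eq_0_if_not_inj)
  next
    case True
    obtain e where e: "bij_betw e {..<CARD('n)} (UNIV :: 'n set)" using ex_bij_betw_last by blast
    then have "inj_on e {..<CARD('n)}" by (simp add: bij_betw_def)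
    moreover then have "inj_on (r \<circ> e) {..<CARD('n)}" using True by (auto intro: comp_inj_on inj_on_subset)
    ultimately have "sub_det A (CARD('n)) (r \<circ> e) e \<in> {0, k, -k, 2*k, -2*k}" using minors by blast
    then show ?thesis unfolding sub_det_eq_minor[OF e, symmetric] by auto
  qed
  have int: "integral_vec (?a j)" for j by (simp add: integral_vec_def row_real_def)
  show thesis
  proof (cases "\<exists>r. \<bar>minor ?a r\<bar> = of_int k")
    case True
    then have "two_modular ?a (nat k)"
      using k1 cases int by unfold_locales auto
    then show thesis by (rule that)
  next
    case False
    obtain r where r: "minor ?a r \<noteq> 0" using span by (rule ex_minor_nz)
    have "minor ?a r \<in> {0, 2 * of_int k, - (2 * of_int k)}" for r
    proof -
      have "\<bar>minor ?a r\<bar> \<noteq> of_int k" using False by blast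
      then show ?thesis using cases[of r] k1 by auto
    qed
    note c2 = this
    have "\<bar>minor ?a r\<bar> = 2 * of_int k" using c2[of r] r k1 by auto
    then have "\<exists>r. \<bar>minor ?a r\<bar> = real (nat (2 * k))" using k1 by (intro exI[of _ r]) auto
    moreover have "minor ?a r \<in> {0, real (nat (2 * k)), - real (nat (2 * k)), 2 * real (nat (2 * k)), - (2 * real (nat (2 * k)))}" for r
      using c2[of r] k1 by auto
    ultimately have "two_modular ?a (nat (2 * k))"
      using k1 int by unfold_locales auto
    then show thesis by (rule that)
  qed
qed

text \<open>\<open>E\<close> will be \<open>K\<close>, or twice it for a vertex outside the lattice.
  The maximum is at least \<open>E\<close>, so its \<open>E\<close>-th part, which is taken off, is
  at least 1.\<close>

lemma proximity_arith:
  fixes \<Delta>' \<Delta> E :: real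
  assumes "E \<ge> 1" "\<Delta> \<ge> E" "\<Delta>' \<ge> 0"
  shows "(1 - 1 / E) * \<Delta>' \<le> max \<Delta>' \<Delta> - 1"
proof -
  have "(1 - 1 / E) * \<Delta>' \<le> (1 - 1 / E) * max \<Delta>' \<Delta>"
    using assms by (intro mult_left_mono) auto
  also have "\<dots> = max \<Delta>' \<Delta> - max \<Delta>' \<Delta> / E" by (simp add: algebra_simps)
  also have "\<dots> \<le> max \<Delta>' \<Delta> - 1" using assms by simp
  finally show ?thesis .
qed

lemma infnorm_cart_le:
  fixes x :: "real^'n"
  assumes "\<And>i. \<bar>x $ i\<bar> \<le> B"
  shows "infnorm x \<le> B"
  unfolding infnorm_Max using assms by (auto simp: Basis_vec_def inner_axis)

theorem two_modular_proximity:
  fixes A :: "int^'n^'m" and b :: "int^'m" and c :: "real^'n"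
  assumes "two_modular (row_real A) K" "\<forall>i. c $ i \<in> \<rat>"
    and xs: "xs extreme_point_of polyh A b" and opt: "\<forall>y\<in>polyh A b. c \<bullet> y \<le> c \<bullet> xs"
    and z0: "z0 \<in> polyh A b" "integral_vec z0"
  shows "\<exists>zs\<in>polyh A b. integral_vec zs \<and>
            (\<forall>z\<in>polyh A b. integral_vec z \<longrightarrow> c \<bullet> z \<le> c \<bullet> zs) \<and>
            infnorm (xs - zs) \<le> real_of_int (max (Delta (CARD('n) - 1) A) (Delta (CARD('n)) A)) - 1 \<and>
            infnorm (xs - zs) < real_of_int (Delta (CARD('n) - 1) A)"
proof -
  interpret two_modular "row_real A" K by fact
  let ?a = "row_real A"
  define D' where "D' = real_of_int (Delta (CARD('n) - 1) A)"
  define D where "D = real_of_int (Delta (CARD('n)) A)"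
  \<comment> \<open>Starting from an optimal integral point, the closer one found below is no worse,
    hence optimal too.\<close>
  obtain z1 where z1: "z1 \<in> polyh A b" "integral_vec z1" "\<forall>y\<in>polyh A b. integral_vec y \<longrightarrow> c \<bullet> y \<le> c \<bullet> z1"
    using assms(2) opt z0 by (rule ex_integral_maximizer)
  \<comment> \<open>Low enough for the slab to contain \<open>xs\<close> and \<open>z1\<close>;
    being part of the polyhedron, the slab keeps \<open>xs\<close> extreme and optimal.\<close>
  define l where "l = (\<lambda>j. min \<lfloor>?a j \<bullet> xs\<rfloor> \<lfloor>?a j \<bullet> z1\<rfloor>)"
  have sub: "slab ?a l (($) b) \<subseteq> polyh A b" by (auto simp: slab_def polyh_def)
  have xsP: "xs \<in> polyh A b" using xs by (simp add: extreme_point_of_def)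
  have "xs \<in> slab ?a l (($) b)" "z1 \<in> slab ?a l (($) b)"
    using xsP z1(1) by (auto simp: slab_def polyh_def l_def le_floor_iff[symmetric])
  then have xs': "xs extreme_point_of slab ?a l (($) b)" and z1': "z1 \<in> slab ?a l (($) b)"
    using xs sub by (auto simp: extreme_point_of_def)
  have opt': "\<forall>y\<in>slab ?a l (($) b). c \<bullet> y \<le> c \<bullet> xs" using opt sub by blast
  obtain z where z: "z \<in> slab ?a l (($) b)" "integral_vec z" "c \<bullet> z1 \<le> c \<bullet> z"
    "\<forall>f \<beta>. step_bound f \<beta> \<longrightarrow>
      \<bar>f \<bullet> (z - xs)\<bar> \<le> (if row_integral xs then real K - 1 else real K - 1 / 2) * \<beta> / real K"
    by (rule slab_proximity[OF xs' opt' z1' z1(2)])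
  obtain r0 where r0: "\<bar>minor ?a r0\<bar> = real K" using ex_minor_k by blast
  have DK: "D \<ge> real K"
    using minor_le_Delta[of A r0] r0 k_pos by (auto simp: D_def)
  \<comment> \<open>Positivity is what makes the second bound strict.\<close>
  have D'pos: "D' > 0"
  proof -
    obtain p :: 'n where True by blast
    have "cofactor_vec ?a r0 p \<bullet> ?a (r0 p) = minor ?a r0"
      by (simp add: cofactor_vec_inner_row fun_upd_idem)
    then have "cofactor_vec ?a r0 p \<noteq> 0" using r0 k_pos by auto
    moreover then obtain j where "cofactor_vec ?a r0 p $ j \<noteq> 0" by (auto simp: vec_eq_iff)
    ultimately show ?thesis using cofactor_vec_le_Delta[of A r0 p j] by (simp add: D'_def)
  qed
  have bound: "step_bound (axis i 1) D'" for i
    unfolding step_bound_def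
  proof (intro allI)
    fix r p
    show "\<bar>axis i 1 \<bullet> cofactor_vec ?a r p\<bar> \<le> D'"
      using cofactor_vec_le_Delta[of A r p i] D'pos
      by (cases "cofactor_vec ?a r p = 0") (auto simp: inner_axis' D'_def)
  qed
  define E where "E = (if row_integral xs then real K else 2 * real K)"
  have E: "E \<ge> 1" "D \<ge> E"
  proof -
    show "E \<ge> 1" using k_pos by (simp add: E_def)
    show "D \<ge> E"
    proof (cases "row_integral xs")
      case False
      then obtain r where "\<bar>minor ?a r\<bar> = 2 * real K" by (rule extreme_point_minor_2k[OF xs'])
      then show ?thesis using minor_le_Delta[of A r] k_pos False by (auto simp: D_def E_def)
    qed (use DK in \<open>simp add: E_def\<close>)
  qed
  have factor: "(if row_integral xs then real K - 1 else real K - 1 / 2) * D' / real K = (1 - 1 / E) * D'"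
    using k_pos by (simp add: E_def field_simps)
  have "\<bar>(xs - z) $ i\<bar> \<le> (1 - 1 / E) * D'" for i
  proof -
    have "\<bar>axis i 1 \<bullet> (z - xs)\<bar> \<le> (1 - 1 / E) * D'"
      using z(4) bound unfolding factor[symmetric] by blast
    then show ?thesis by (simp add: inner_axis' abs_minus_commute)
  qed
  then have le: "infnorm (xs - z) \<le> (1 - 1 / E) * D'" by (rule infnorm_cart_le)
  have "(1 - 1 / E) * D' \<le> max D' D - 1" using E D'pos by (intro proximity_arith) auto
  moreover have "(1 - 1 / E) * D' < D'" using E D'pos by (simp add: field_simps)
  ultimately have "infnorm (xs - z) \<le> max D' D - 1" "infnorm (xs - z) < D'" using le by auto
  moreover have "max D' D = real_of_int (max (Delta (CARD('n) - 1) A) (Delta (CARD('n)) A))"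
    by (simp add: D_def D'_def of_int_max)
  moreover have "\<forall>y\<in>polyh A b. integral_vec y \<longrightarrow> c \<bullet> y \<le> c \<bullet> z" using z1(3) z(3) by force
  ultimately show ?thesis
    using z(1,2) sub by (intro bexI[of _ z]) (auto simp: D'_def)
qed

text \<open>An integral point for \<open>u\<close> must overshoot \<open>b'\<close> in row
  \<open>i\<close>, while one is found at most \<open>D - 1\<close> above the minimum of this row.
  So the minimum is at least \<open>b' i + 1 - (D - 1)\<close>, and the maximum over the polyhedron
  is at most \<open>b $ i \<le> b' i\<close>.\<close>

theorem two_modular_flatness:
  fixes A :: "int^'n^'m" and b :: "int^'m"
  assumes "two_modular (row_real A) K" and free: "\<forall>z\<in>polyh A b. \<not> integral_vec z"
  shows "\<exists>i. width (row_real A i) (polyh A b) \<le> ereal (real_of_int (Delta (CARD('n)) A - 2))"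
proof -
  interpret two_modular "row_real A" K by fact
  let ?a = "row_real A"
  define D where "D = real_of_int (Delta (CARD('n)) A)"
  obtain r0 where r0: "\<bar>minor ?a r0\<bar> = real K" using ex_minor_k by blast
  have "D \<ge> real K" using minor_le_Delta[of A r0] r0 k_pos by (auto simp: D_def)
  then have minD: "\<bar>minor ?a r\<bar> \<le> D" for r
    using minor_le_Delta[of A r] by (cases "minor ?a r = 0") (auto simp: D_def)
  define F where "F = (\<lambda>\<beta>::'m \<Rightarrow> int. \<exists>z. integral_vec z \<and> (\<forall>j. ?a j \<bullet> z \<le> of_int (\<beta> j)))"
  \<comment> \<open>This right-hand side admits the origin.\<close>
  have "F (\<lambda>j. max (b $ j) 0)" unfolding F_def by (intro exI[of _ 0]) auto
  moreover have "\<not> F (($) b)" using free by (auto simp: F_def polyh_def)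
  moreover have "\<forall>j. b $ j \<le> max (b $ j) 0" by simp
  ultimately have "\<exists>b' i. (\<forall>j. b $ j \<le> b' j) \<and> \<not> F b' \<and> F (b'(i := b' i + 1))"
    using first_feasible_increment by blast
  then obtain b' i where b': "\<And>j. b $ j \<le> b' j" "\<not> F b'" "F (b'(i := b' i + 1))" by blast
  define u where "u = b'(i := b' i + 1)"
  obtain z0 where z0: "integral_vec z0" "\<And>j. ?a j \<bullet> z0 \<le> of_int (u j)"
    using b'(3) by (auto simp: F_def u_def)
  have low: "?a i \<bullet> x \<ge> of_int (b $ i) - (D - 2)" if x: "x \<in> polyh A b" for x
  proof -
    \<comment> \<open>The slab is chosen anew for each \<open>x\<close>, with lower bounds that
      admit both \<open>x\<close> and \<open>z0\<close>.\<close>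
    define l where "l = (\<lambda>j. min \<lfloor>?a j \<bullet> x\<rfloor> \<lfloor>?a j \<bullet> z0\<rfloor>)"
    have "?a j \<bullet> x \<le> of_int (u j)" for j
    proof -
      have "?a j \<bullet> x \<le> of_int (b $ j)" using x by (simp add: polyh_def)
      also have "\<dots> \<le> of_int (u j)" using b'(1)[of j] by (auto simp: u_def)
      finally show ?thesis .
    qed
    then have xQ: "x \<in> slab ?a l u" and z0Q: "z0 \<in> slab ?a l u"
      using z0(2) by (auto simp: slab_def l_def le_floor_iff[symmetric])
    obtain xs where xs: "xs extreme_point_of slab ?a l u" "\<forall>y\<in>slab ?a l u. ?a i \<bullet> xs \<le> ?a i \<bullet> y"
      by (rule ex_extreme_minimizer[OF compact_slab[OF spanning_UNIV] convex_slab]) (use xQ in auto)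
    obtain z where z: "z \<in> slab ?a l u" "integral_vec z" "?a i \<bullet> z \<le> ?a i \<bullet> xs + (D - 1)"
      by (rule slab_proximity_row[OF xs z0Q z0(1) minD])
    have "\<not> ?a i \<bullet> z \<le> of_int (b' i)"
    proof
      assume "?a i \<bullet> z \<le> of_int (b' i)"
      moreover have "?a j \<bullet> z \<le> of_int (b' j)" if "j \<noteq> i" for j
        using z(1) that by (auto simp: slab_def u_def split: if_splits dest: spec[of _ j])
      ultimately have "F b'" unfolding F_def using z(2) by metis
      then show False using b'(2) by simp
    qed
    moreover have "?a i \<bullet> z \<in> \<int>" using z(2) integral_row by (intro integral_vec_inner)
    ultimately have "of_int (b' i) + 1 \<le> ?a i \<bullet> z"
      using Ints_less_add_1[of "?a i \<bullet> z" "of_int (b' i)"] by fastforce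
    moreover have "real_of_int (b $ i) \<le> of_int (b' i)" using b'(1) by simp
    moreover have "?a i \<bullet> xs \<le> ?a i \<bullet> x" using xs(2) xQ by blast
    ultimately show ?thesis using z(3) by linarith
  qed
  have "(SUP x\<in>polyh A b. ereal (?a i \<bullet> x)) \<le> ereal (of_int (b $ i))"
    by (intro SUP_least) (simp add: polyh_def)
  moreover have "ereal (of_int (b $ i) - (D - 2)) \<le> (INF y\<in>polyh A b. ereal (?a i \<bullet> y))"
    using low by (intro INF_greatest) simp
  ultimately have "width (?a i) (polyh A b) \<le> ereal (of_int (b $ i)) - ereal (of_int (b $ i) - (D - 2))"
    unfolding width_def by (rule ereal_minus_mono)
  then show ?thesis by (intro exI[of _ i]) (simp add: D_def)
qed

theorem theorem6:
  fixes A :: "int^'n^'m" and k :: int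
  assumes n2: "CARD('n) \<ge> 2"
    and fullrank: "rank (real_mat A) = CARD('n)"
    and k1: "k \<ge> 1"
    and minors: "\<And>f g. inj_on f {..<CARD('n)} \<Longrightarrow> inj_on g {..<CARD('n)} \<Longrightarrow>
                   sub_det A (CARD('n)) f g \<in> {0, k, -k, 2*k, -2*k}"
  shows
    "(\<forall>(b::int^'m) (c::real^'n) xs.
        (\<forall>i. c $ i \<in> \<rat>) \<longrightarrow>
        xs extreme_point_of polyh A b \<longrightarrow>
        (\<forall>y\<in>polyh A b. c \<bullet> y \<le> c \<bullet> xs) \<longrightarrow>
        (\<exists>z\<in>polyh A b. integral_vec z) \<longrightarrow>
        (\<exists>zs\<in>polyh A b. integral_vec zs \<and>
            (\<forall>z\<in>polyh A b. integral_vec z \<longrightarrow> c \<bullet> z \<le> c \<bullet> zs) \<and>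
            infnorm (xs - zs) \<le> real_of_int (max (Delta (CARD('n) - 1) A) (Delta (CARD('n)) A)) - 1 \<and>
            infnorm (xs - zs) < real_of_int (Delta (CARD('n) - 1) A)))
     \<and>
     (\<forall>b::int^'m.
        aff_dim (polyh A b) = int CARD('n) \<longrightarrow>
        (\<forall>z\<in>polyh A b. \<not> integral_vec z) \<longrightarrow>
        (\<forall>i. {x\<in>polyh A b. row_real A i \<bullet> x = real_of_int (b $ i)} facet_of polyh A b) \<longrightarrow>
        (\<exists>i. width (row_real A i) (polyh A b) \<le> ereal (real_of_int (Delta (CARD('n)) A - 2))))"
proof -
  obtain K where K: "two_modular (row_real A) K"
    using fullrank k1 minors by (rule two_modular_row_real)
  show ?thesis
    by (intro conjI allI impI; (elim bexE)?) (rule two_modular_proximity[OF K] two_modular_flatness[OF K]; assumption)+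
qed

end
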